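(* Let $P\subset\mathbb{R}^d$ be a $d$-dimensional lattice polytope that is Gorenstein of index $g$, with $f^*$-vector $(f^*_0,\dots,f^*_d)$. Then $f^*_{k-1} > f^*_k$ for all integers $k$ with $\frac12\left(d+1+\left\lfloor \frac{d+1-g}{2}\right\rfloor\right)\leq k\leq d$.
   Context: A lattice polytope is the convex hull of finitely many points of $\mathbb{Z}^d$. For a $d$-dimensional lattice polytope $P\subset\mathbb{R}^d$ and a positive integer $n$, let $\operatorname{ehr}_P(n)=|nP\cap\mathbb{Z}^d|$ (a polynomial in $n$ of degree $d$). The $f^*$-vector $(f^*_0,\dots,f^*_d)$ of $P$ is defined by $\operatorname{ehr}_P(n)=\sum_{k=0}^d f^*_k\binom{n-1}{k}$ for all positive integers $n$. A lattice polytope $P$ is Gorenstein of index $g$ (a positive integer) if: $nP$ contains no interior lattice points for $1\le n<g$; $gP$ contains a unique interior lattice point; and for all integers $n>g$, $\operatorname{ehr}_P(n-g)$ equals the number of lattice points in the interior of $nP$. *)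

theory Defs
  imports "HOL-Analysis.Analysis"
begin

text \<open>The lattice \<open>\<int>\<^sup>d\<close> inside \<open>\<real>\<^sup>d\<close>, where \<open>d = CARD('d)\<close>.\<close>

definition int_lattice :: "(real ^ 'd) set" where
  "int_lattice = {x. \<forall>i. x $ i \<in> \<int>}"

definition lattice_polytope :: "(real ^ 'd) set \<Rightarrow> bool" where
  "lattice_polytope P \<longleftrightarrow> (\<exists>V. finite V \<and> V \<subseteq> int_lattice \<and> P = convex hull V)"

definition dilate :: "nat \<Rightarrow> (real ^ 'd) set \<Rightarrow> (real ^ 'd) set" where
  "dilate n P = (\<lambda>x. real n *\<^sub>R x) ` P"

definition ehr :: "(real ^ 'd) set \<Rightarrow> nat \<Rightarrow> nat" where
  "ehr P n = card (dilate n P \<inter> int_lattice)"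

text \<open>
  The defining equations determine the entries \<open>f 0, \<dots>, f d\<close> uniquely; the values
  of \<open>f\<close> beyond \<open>d\<close> are irrelevant. The summation bound is the dimension of the ambient
  space, so this is meant for full-dimensional \<open>P\<close>.
\<close>

definition is_f_star_vector :: "(real ^ 'd) set \<Rightarrow> (nat \<Rightarrow> real) \<Rightarrow> bool" where
  "is_f_star_vector P f \<longleftrightarrow>
     (\<forall>n\<ge>1. real (ehr P n) = (\<Sum>k=0..CARD('d). f k * real ((n - 1) choose k)))"

text \<open>
  As \<open>interior\<close> is the topological interior in the ambient space, this too is meant for
  full-dimensional \<open>P\<close>.
\<close>

definition gorenstein_of_index :: "(real ^ 'd) set \<Rightarrow> nat \<Rightarrow> bool" where
  "gorenstein_of_index P g \<longleftrightarrow>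
     g \<ge> 1 \<and>
     (\<forall>n. 1 \<le> n \<and> n < g \<longrightarrow> interior (dilate n P) \<inter> int_lattice = {}) \<and>
     (\<exists>!x. x \<in> interior (dilate g P) \<inter> int_lattice) \<and>
     (\<forall>n>g. ehr P (n - g) = card (interior (dilate n P) \<inter> int_lattice))"

end

theory Submission
  imports Defs "HOL-Computational_Algebra.Polynomial"
begin

text \<open>
  Lift \<open>P\<close> to height one and triangulate the cone over it by the bases \<open>B\<close> of vertices that are
  optimal for a generic linear program. Moving lattice points by an infinitesimal multiple of a
  generic interior vector \<open>q\<close> turns the triangulation into a partition into half-open simplicial
  cones; moving them by \<open>- q\<close> partitions the interior. Writing every lattice point of such a cone
  as a point of the half-open parallelepiped plus a natural combination of generators gives a
  nonnegative \<open>h\<^sup>*\<close>-vector with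
  \<open>ehr P n = (\<Sum>j. h j * (n + d - j choose d))\<close> (truncated subtraction is harmless: the
  terms with \<open>j > n\<close> vanish since \<open>d \<ge> 1\<close>), and the point reflection of the parallelepipeds
  gives reciprocity, i.e. the reversed vector counts interior points. For Gorenstein \<open>P\<close> it follows
  that \<open>h j = h (s - j)\<close> with \<open>s = d + 1 - g\<close>. Finally
  \<open>f (k - 1) - f k = (\<Sum>j. h j * D (d + 1 - j))\<close> for
  \<open>D x = (x choose d + 1 - k) - (x choose d - k)\<close>, and for \<open>k\<close> in the given range
  \<open>D (d + 1 - j) + D (d + 1 - (s - j)) > 0\<close>.
\<close>

section \<open>Linear inequalities for symmetric coefficient vectors\<close>

text \<open>The system is triangular with unit diagonal: in the \<open>n\<close>-th equation the
  coefficient of \<open>c n\<close> is \<open>d choose d\<close>.\<close>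

lemma binomial_series_eqI:
  fixes c e :: "nat \<Rightarrow> nat"
  assumes "\<And>n. (\<Sum>j\<le>n. c j * ((n + d - j) choose d)) = (\<Sum>j\<le>n. e j * ((n + d - j) choose d))"
  shows "c n = e n"
proof (induction n rule: less_induct)
  case (less n)
  have "(\<Sum>j<n. c j * ((n + d - j) choose d)) = (\<Sum>j<n. e j * ((n + d - j) choose d))"
    by (intro sum.cong) (use less in auto)
  then show ?case
    using assms[of n] by (simp add: lessThan_Suc_atMost[symmetric])
qed

text \<open>Brings a sum of fixed length into the triangular form compared in
  \<open>binomial_series_eqI\<close>. For \<open>j > n\<close> the upper index is below
  \<open>d\<close>, even where the subtraction truncates to 0, because
  \<open>d \<ge> 1\<close>.\<close>

lemma binomial_sum_cutoff:
  fixes c :: "nat \<Rightarrow> nat"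
  assumes "d \<ge> 1"
  shows "(\<Sum>j\<le>m. c j * ((n + d - j) choose d)) =
         (\<Sum>j\<le>n. (if j \<le> m then c j else 0) * ((n + d - j) choose d))"
proof -
  have "(\<Sum>j\<le>m. c j * ((n + d - j) choose d)) = (\<Sum>j\<in>{..m} \<inter> {..n}. c j * ((n + d - j) choose d))"
    using assms by (intro sum.mono_neutral_right) auto
  also have "\<dots> = (\<Sum>j\<in>{..m} \<inter> {..n}. (if j \<le> m then c j else 0) * ((n + d - j) choose d))"
    by (intro sum.cong) auto
  also have "\<dots> = (\<Sum>j\<le>n. (if j \<le> m then c j else 0) * ((n + d - j) choose d))"
    by (intro sum.mono_neutral_left) auto
  finally show ?thesis .
qed

text \<open>Vandermonde, applied with \<open>n = m + 1\<close> to
  \<open>(m + (d + 1 - j)) choose d\<close>, expands \<open>L\<close> in the functions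
  \<open>m choose k\<close>. Coefficients in that basis are unique, as evaluation at
  \<open>m = 0, 1, ...\<close> is again triangular.\<close>

lemma f_star_vector_h_star:
  fixes h :: "nat \<Rightarrow> nat" and f :: "nat \<Rightarrow> real"
  assumes L: "\<And>n. L n = (\<Sum>j\<le>d+1. h j * ((n + d - j) choose d))"
    and f: "\<And>n. n \<ge> 1 \<Longrightarrow> real (L n) = (\<Sum>k=0..d. f k * real ((n - 1) choose k))"
    and "k \<le> d"
  shows "f k = (\<Sum>j\<le>d+1. real (h j) * real ((d + 1 - j) choose (d - k)))"
proof -
  define f' where "f' k = (\<Sum>j\<le>d+1. real (h j) * real ((d + 1 - j) choose (d - k)))" for k
  have f': "real (L (Suc m)) = (\<Sum>k\<le>d. f' k * real (m choose k))" for m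
  proof -
    have "L (Suc m) = (\<Sum>j\<le>d+1. h j * (\<Sum>k\<le>d. (m choose k) * ((d + 1 - j) choose (d - k))))"
      unfolding L by (intro sum.cong) (auto simp: vandermonde)
    also have "\<dots> = (\<Sum>k\<le>d. \<Sum>j\<le>d+1. h j * ((m choose k) * ((d + 1 - j) choose (d - k))))"
      unfolding sum_distrib_left by (rule sum.swap)
    finally show ?thesis
      by (simp add: f'_def sum_distrib_left sum_distrib_right mult_ac del: sum.atMost_Suc)
  qed
  have eq: "(\<Sum>k\<le>d. f k * real (m choose k)) = (\<Sum>k\<le>d. f' k * real (m choose k))" for m
    using f[of "Suc m"] f'[of m] by (simp add: atLeast0AtMost)
  have "f k = f' k" using \<open>k \<le> d\<close>
  proof (induction k rule: less_induct)
    case (less k)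
    have cut: "(\<Sum>i\<le>d. g i * real (k choose i)) = (\<Sum>i<k. g i * real (k choose i)) + g k" for g :: "nat \<Rightarrow> real"
    proof -
      have "(\<Sum>i\<le>d. g i * real (k choose i)) = (\<Sum>i\<le>k. g i * real (k choose i))"
        using less.prems by (intro sum.mono_neutral_right) auto
      then show ?thesis by (simp add: lessThan_Suc_atMost[symmetric])
    qed
    have "(\<Sum>i<k. f i * real (k choose i)) = (\<Sum>i<k. f' i * real (k choose i))"
      by (intro sum.cong) (use less in auto)
    then show ?case using eq[of k] by (simp add: cut)
  qed
  then show ?thesis by (simp add: f'_def)
qed

text \<open>Absorption makes the difference a multiple of \<open>a choose (m - 1)\<close>, so where
  that binomial is nonzero the sign is that of \<open>a + 1 - 2 * m\<close>.\<close>

lemma choose_diff_eq: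
  assumes "m \<ge> 1"
  shows "real m * (real (a choose m) - real (a choose (m - 1))) =
         real (a choose (m - 1)) * (real a + 1 - 2 * real m)"
proof -
  obtain p where p: "m = Suc p" using assms by (cases m) auto
  show ?thesis
  proof (cases "p \<le> a")
    case True
    have "Suc p * (a choose Suc p) = (a - p) * (a choose p)"
      using binomial_absorb_comp binomial_absorption by simp
    then have "real (Suc p) * real (a choose Suc p) = (real a - real p) * real (a choose p)"
      using True by (metis of_nat_diff of_nat_mult)
    then show ?thesis by (simp add: p algebra_simps)
  qed (simp add: p binomial_eq_0)
qed

text \<open>For \<open>b \<le> a\<close>, multiplying by \<open>m\<close> gives
  \<open>A * X + B * Y\<close> with \<open>B \<le> A\<close>, \<open>0 < A\<close>,
  \<open>0 < X\<close> and \<open>0 < X + Y\<close>. A negative \<open>Y\<close> carries the smaller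
  weight and cannot outweigh \<open>X\<close>.\<close>

lemma choose_diff_pair_pos:
  assumes "m \<ge> 1" "4 * m \<le> a + b + 1"
  shows "real (a choose m) - real (a choose (m - 1)) + (real (b choose m) - real (b choose (m - 1))) > 0"
  using assms(2)
proof (induction b a rule: linorder_wlog)
  case (le b a)
  define X Y where "X = real a + 1 - 2 * real m" and "Y = real b + 1 - 2 * real m"
  have X: "X > 0" and XY: "X + Y > 0"
    using le by (auto simp: X_def Y_def)
  have "m - 1 \<le> a" using le by linarith
  then have a: "real (a choose (m - 1)) > 0" by simp
  have ba: "real (b choose (m - 1)) \<le> real (a choose (m - 1))"
    using le by (simp add: binomial_right_mono)
  have "real (a choose (m - 1)) * X + real (b choose (m - 1)) * Y > 0"
  proof (cases "Y \<ge> 0")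
    case True
    then show ?thesis using a X by (intro add_pos_nonneg) auto
  next
    case False
    then have "real (b choose (m - 1)) * Y \<ge> real (a choose (m - 1)) * Y"
      using ba by (intro mult_right_mono_neg) auto
    moreover have "real (a choose (m - 1)) * (X + Y) > 0" using a XY by simp
    ultimately show ?thesis by (simp add: distrib_left)
  qed
  also have "real (a choose (m - 1)) * X + real (b choose (m - 1)) * Y =
    real m * (real (a choose m) - real (a choose (m - 1)) + (real (b choose m) - real (b choose (m - 1))))"
    unfolding X_def Y_def distrib_left[of "real m" "_ - _" "_ - _"] choose_diff_eq[OF assms(1)] by simp
  finally show ?case by (simp add: zero_less_mult_iff)
qed (simp add: add_ac)

text \<open>Separates the arithmetic from the geometry: \<open>L\<close> and \<open>I\<close> stand
  for the counts of all and of interior lattice points. The bound on \<open>g\<close> is exported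
  because it makes the natural subtraction \<open>d + 1 - g\<close> faithful.\<close>

theorem gorenstein_f_star_decreasing:
  fixes h L I :: "nat \<Rightarrow> nat" and f :: "nat \<Rightarrow> real"
  assumes d: "d \<ge> 1" and g: "g \<ge> 1"
    and L: "\<And>n. L n = (\<Sum>j\<le>d+1. h j * ((n + d - j) choose d))"
    and I: "\<And>n. I n = (\<Sum>j\<le>d+1. h (d + 1 - j) * ((n + d - j) choose d))"
    and L0: "L 0 = 1"
    and I_lt: "\<And>n. n < g \<Longrightarrow> I n = 0" and I_g: "I g = 1" and I_gt: "\<And>n. n > g \<Longrightarrow> L (n - g) = I n"
    and f: "\<And>n. n \<ge> 1 \<Longrightarrow> real (L n) = (\<Sum>k=0..d. f k * real ((n - 1) choose k))"
  shows "g \<le> d + 1"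
    and "d + 1 + (d + 1 - g) div 2 \<le> 2 * k \<Longrightarrow> k \<le> d \<Longrightarrow> f (k - 1) > f k"
proof -
  \<comment> \<open>\<open>c\<close> is the reversed vector and \<open>e\<close> the vector shifted
    by \<open>g\<close>. Both are cut off explicitly, since nothing is known about \<open>h\<close>
    beyond \<open>d + 1\<close>.\<close>
  define c where "c j = (if j \<le> d + 1 then h (d + 1 - j) else 0)" for j
  define h' where "h' j = (if j \<le> d + 1 then h j else 0)" for j
  define e where "e j = (if g \<le> j then h' (j - g) else 0)" for j
  have L': "L n = (\<Sum>j\<le>n. h' j * ((n + d - j) choose d))" for n
    unfolding L h'_def using binomial_sum_cutoff[OF d] .
  have I': "I n = (\<Sum>j\<le>n. c j * ((n + d - j) choose d))" for n
    unfolding I c_def using binomial_sum_cutoff[OF d] .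
  have I'': "I n = (\<Sum>j\<le>n. e j * ((n + d - j) choose d))" for n
  proof (cases "n < g")
    case True
    then show ?thesis by (simp add: I_lt e_def)
  next
    case False
    \<comment> \<open>The case \<open>n = g\<close> lies outside \<open>I_gt\<close>; there both
      sides are 1.\<close>
    have "I n = L (n - g)"
      using False I_gt[of n] I_g L0 by (cases "n = g") auto
    also have "\<dots> = (\<Sum>j\<in>{g..n}. e j * ((n + d - j) choose d))"
      unfolding L'
      by (rule sum.reindex_bij_witness[where i = "\<lambda>j. j - g" and j = "\<lambda>j. j + g"])
        (use False in \<open>auto simp: e_def add_ac\<close>)
    also have "\<dots> = (\<Sum>j\<le>n. e j * ((n + d - j) choose d))"
      by (intro sum.mono_neutral_left) (auto simp: e_def)
    finally show ?thesis .
  qed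
  have ce: "c j = e j" for j
    using binomial_series_eqI[of c d e j] I' I'' by simp
  have h0: "h 0 = 1" using L'[of 0] L0 by (simp add: h'_def)
  \<comment> \<open>\<open>e g = h 0 = 1\<close>, whereas \<open>c\<close> vanishes beyond
    \<open>d + 1\<close>.\<close>
  show gd: "g \<le> d + 1"
    using ce[of g] h0 by (auto simp: c_def e_def h'_def split: if_splits)
  define s where "s = d + 1 - g"
  have sym: "h (s - j) = h j" if "j \<le> s" for j
  proof -
    have "g + j \<le> d + 1" "j \<le> d + 1" "s - j = d + 1 - (g + j)"
      using that gd by (auto simp: s_def)
    then show ?thesis
      using ce[of "g + j"] unfolding c_def e_def h'_def by simp
  qed
  \<comment> \<open>Here \<open>j + g\<close> exceeds \<open>d + 1\<close>, so
    \<open>c (j + g) = 0\<close>, while \<open>e (j + g) = h j\<close>.\<close>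
  have top: "h j = 0" if "s < j" "j \<le> d + 1" for j
    using ce[of "j + g"] that gd by (auto simp: c_def e_def h'_def s_def split: if_splits)
  show "f (k - 1) > f k" if k: "d + 1 + (d + 1 - g) div 2 \<le> 2 * k" "k \<le> d"
  proof -
    define m where "m = d + 1 - k"
    define D where "D a = real (a choose m) - real (a choose (m - 1))" for a
    have "k \<ge> 1" using k by linarith
    then have m: "m \<ge> 1" "d - (k - 1) = m" "d - k = m - 1" using k by (auto simp: m_def)
    have "f (k - 1) - f k = (\<Sum>j\<le>d+1. real (h j) * D (d + 1 - j))"
      using f_star_vector_h_star[of L h d f k, OF L f] f_star_vector_h_star[of L h d f "k - 1", OF L f] k m
      by (simp add: D_def right_diff_distrib sum_subtractf del: sum.atMost_Suc)
    also have "\<dots> = (\<Sum>j\<le>s. real (h j) * D (d + 1 - j))"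
      by (intro sum.mono_neutral_right) (auto simp: s_def intro!: top)
    finally have 1: "f (k - 1) - f k = (\<Sum>j\<le>s. real (h j) * D (d + 1 - j))" .
    also have "\<dots> = (\<Sum>j\<le>s. real (h j) * D (d + 1 - (s - j)))"
      by (rule sum.reindex_bij_witness[where i = "\<lambda>j. s - j" and j = "\<lambda>j. s - j"]) (auto simp: sym)
    finally have 2: "2 * (f (k - 1) - f k) = (\<Sum>j\<le>s. real (h j) * (D (d + 1 - j) + D (d + 1 - (s - j))))"
      using 1 by (simp add: distrib_left sum.distrib)
    have pos: "D (d + 1 - j) + D (d + 1 - (s - j)) > 0" if "j \<le> s" for j
      unfolding D_def
    proof (rule choose_diff_pair_pos)
      \<comment> \<open>The two arguments add up to \<open>2 * (d + 1) - s\<close>, and the bound on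
        \<open>k\<close> yields \<open>4 * k \<ge> 2 * (d + 1) + s - 1\<close>. The 1 lost in
        rounding \<open>s div 2\<close> is absorbed by the \<open>+ 1\<close> in
        \<open>choose_diff_pair_pos\<close>.\<close>
      show "4 * m \<le> d + 1 - j + (d + 1 - (s - j)) + 1"
        using that k gd unfolding m_def s_def by linarith
    qed (fact m(1))
    \<comment> \<open>All terms are nonnegative, and \<open>h 0 = 1\<close> makes the first one
      strictly positive.\<close>
    have "0 < (\<Sum>j\<le>s. real (h j) * (D (d + 1 - j) + D (d + 1 - (s - j))))"
    proof (rule sum_pos2[of _ 0])
      show "0 < real (h 0) * (D (d + 1 - 0) + D (d + 1 - (s - 0)))"
        using pos[of 0] h0 by simp
      show "0 \<le> real (h j) * (D (d + 1 - j) + D (d + 1 - (s - j)))" if "j \<in> {..s}" for j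
        using pos[of j] that by (intro mult_nonneg_nonneg) auto
    qed auto
    then show ?thesis using 2 by simp
  qed
qed

section \<open>Coordinates in a basis and infinitesimal shifts\<close>

lemma representation_sum_scaleR:
  fixes B :: "'a::euclidean_space set"
  assumes "independent B" "b \<in> B"
  shows "representation B (\<Sum>b\<in>B. c b *\<^sub>R b) b = c b"
proof -
  have "finite B" using assms(1) by (rule independent_imp_finite)
  have "(\<Sum>b\<in>B. c b *\<^sub>R b) \<in> span B"
    by (intro span_sum span_scale span_base)
  moreover have "(\<Sum>b | (if b \<in> B then c b else 0) \<noteq> 0. (if b \<in> B then c b else 0) *\<^sub>R b) = (\<Sum>b\<in>B. c b *\<^sub>R b)"
    using \<open>finite B\<close> by (intro sum.mono_neutral_cong_left) auto
  ultimately have "representation B (\<Sum>b\<in>B. c b *\<^sub>R b) = (\<lambda>b. if b \<in> B then c b else 0)"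
    using assms(1) \<open>finite B\<close> by (intro representation_eqI) (auto split: if_splits)
  then show ?thesis using assms by simp
qed

text \<open>Only \<open>\<alpha> = 0\<close> is delicate: there the sign of \<open>\<beta>\<close>
  decides. The right-hand side is the condition that later defines half-open cones, one coordinate
  at a time.\<close>

lemma eventually_shift_pos_iff:
  fixes \<alpha> \<beta> :: real
  assumes "\<beta> \<noteq> 0"
  shows "eventually (\<lambda>\<epsilon>. 0 < \<alpha> + \<epsilon> * \<beta> \<longleftrightarrow> 0 \<le> \<alpha> \<and> (\<beta> < 0 \<longrightarrow> 0 < \<alpha>)) (at_right 0)"
proof -
  have lim: "((\<lambda>\<epsilon>. \<alpha> + \<epsilon> * \<beta>) \<longlongrightarrow> \<alpha> + 0 * \<beta>) (at_right 0)"
    by (intro tendsto_intros)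
  consider "\<alpha> > 0" | "\<alpha> < 0" | "\<alpha> = 0" by linarith
  then show ?thesis
  proof cases
    case 1
    then show ?thesis using order_tendstoD(1)[OF lim, of 0] by (auto elim: eventually_mono)
  next
    case 2
    then show ?thesis using order_tendstoD(2)[OF lim, of 0] by (auto elim: eventually_mono)
  next
    case 3
    then show ?thesis
      using assms by (intro eventually_mono[OF eventually_at_right_less[of "0::real"]])
        (auto simp: zero_less_mult_iff)
  qed
qed

section \<open>Half-open triangulation of a polyhedral cone\<close>

text \<open>\<open>V\<close> models the vertices lifted to height one, and \<open>a\<close> is the
  height functional.\<close>

locale homogenized =
  fixes V :: "'a::euclidean_space set" and a :: 'a
  assumes finite_V: "finite V" and height_V: "v \<in> V \<Longrightarrow> a \<bullet> v = 1"
begin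

definition bases :: "'a set set" where
  "bases = {B. B \<subseteq> V \<and> independent B \<and> span B = UNIV}"

definition pos_hull :: "'a set" where
  "pos_hull = {x. \<exists>c. (\<forall>v\<in>V. 0 \<le> c v) \<and> x = (\<Sum>v\<in>V. c v *\<^sub>R v)}"

text \<open>The subspaces avoided include every wall of every simplicial cone generated by a basis
  from \<open>V\<close>.\<close>

definition generic :: "'a \<Rightarrow> bool" where
  "generic z \<longleftrightarrow> (\<forall>F\<subseteq>V. z \<in> span F \<longrightarrow> span F = UNIV)"

lemma finite_bases: "finite bases"
  unfolding bases_def using finite_V by auto

lemma basesD:
  assumes "B \<in> bases"
  shows "B \<subseteq> V" "independent B" "span B = UNIV" "finite B" "card B = DIM('a)"
  using assms finite_V unfolding bases_def
  by (auto simp: finite_subset intro: basis_card_eq_dim[of B UNIV, simplified])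

lemma sum_rep:
  assumes "B \<in> bases"
  shows "(\<Sum>b\<in>B. representation B x b *\<^sub>R b) = x"
  using basesD[OF assms] by (intro sum_representation_eq) auto

lemma rep_sum:
  assumes "B \<in> bases" "b \<in> B"
  shows "representation B (\<Sum>b\<in>B. c b *\<^sub>R b) b = c b"
  using basesD[OF assms(1)] assms(2) representation_sum_scaleR by blast

lemma rep_add: "B \<in> bases \<Longrightarrow> representation B (x + y) b = representation B x b + representation B y b"
  using basesD by (simp add: representation_add)

lemma rep_diff: "B \<in> bases \<Longrightarrow> representation B (x - y) b = representation B x b - representation B y b"
  using basesD by (simp add: representation_diff)

lemma rep_uminus: "B \<in> bases \<Longrightarrow> representation B (- x) b = - representation B x b"
  using basesD by (simp add: representation_neg)

lemma rep_scaleR: "B \<in> bases \<Longrightarrow> representation B (r *\<^sub>R x) b = r * representation B x b"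
  using basesD by (simp add: representation_scale)

lemma height_sum:
  assumes "F \<subseteq> V"
  shows "a \<bullet> (\<Sum>v\<in>F. c v *\<^sub>R v) = sum c F"
  unfolding inner_sum_right by (intro sum.cong) (use assms height_V in auto)

lemma height_rep: "B \<in> bases \<Longrightarrow> a \<bullet> x = (\<Sum>b\<in>B. representation B x b)"
  using height_sum[of B "representation B x"] basesD(1) by (simp add: sum_rep)

lemma sum_in_pos_hull:
  assumes "F \<subseteq> V" "\<And>v. v \<in> F \<Longrightarrow> 0 \<le> c v"
  shows "(\<Sum>v\<in>F. c v *\<^sub>R v) \<in> pos_hull"
proof -
  have "(\<Sum>v\<in>F. c v *\<^sub>R v) = (\<Sum>v\<in>V. (if v \<in> F then c v else 0) *\<^sub>R v)"
    by (rule sum.mono_neutral_cong_left) (use assms finite_V in auto)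
  then show ?thesis
    unfolding pos_hull_def mem_Collect_eq using assms(2)
    by (intro exI[of _ "\<lambda>v. if v \<in> F then c v else 0"]) auto
qed

lemma rep_nonneg_in_pos_hull:
  assumes "B \<in> bases" "\<And>b. b \<in> B \<Longrightarrow> 0 \<le> representation B x b"
  shows "x \<in> pos_hull"
  using sum_in_pos_hull[of B "representation B x"] basesD(1)[OF assms(1)] assms by (simp add: sum_rep)

lemma pos_hull_add: "x \<in> pos_hull \<Longrightarrow> y \<in> pos_hull \<Longrightarrow> x + y \<in> pos_hull"
  unfolding pos_hull_def
proof clarify
  fix c d :: "'a \<Rightarrow> real" assume "\<forall>v\<in>V. 0 \<le> c v" "\<forall>v\<in>V. 0 \<le> d v"
  then show "\<exists>e. (\<forall>v\<in>V. 0 \<le> e v) \<and> (\<Sum>v\<in>V. c v *\<^sub>R v) + (\<Sum>v\<in>V. d v *\<^sub>R v) = (\<Sum>v\<in>V. e v *\<^sub>R v)"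
    by (intro exI[of _ "\<lambda>v. c v + d v"]) (auto simp: scaleR_add_left sum.distrib)
qed

lemma pos_hull_scaleR: "x \<in> pos_hull \<Longrightarrow> 0 \<le> r \<Longrightarrow> r *\<^sub>R x \<in> pos_hull"
  unfolding pos_hull_def
proof clarify
  fix c :: "'a \<Rightarrow> real" assume "\<forall>v\<in>V. 0 \<le> c v" "0 \<le> r"
  then show "\<exists>e. (\<forall>v\<in>V. 0 \<le> e v) \<and> r *\<^sub>R (\<Sum>v\<in>V. c v *\<^sub>R v) = (\<Sum>v\<in>V. e v *\<^sub>R v)"
    by (intro exI[of _ "\<lambda>v. r * c v"]) (auto simp: scaleR_sum_right)
qed

lemma height_pos_hull_nonneg: "x \<in> pos_hull \<Longrightarrow> 0 \<le> a \<bullet> x"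
  unfolding pos_hull_def by (auto simp: height_sum intro!: sum_nonneg)

lemma generic_nonzero: "generic z \<Longrightarrow> z \<noteq> 0"
  unfolding generic_def using nonzero_Basis[OF SOME_Basis] by (auto dest!: spec[of _ "{}"])

lemma generic_uminus: "generic (- z) \<longleftrightarrow> generic z"
  unfolding generic_def by (metis minus_minus span_neg)

text \<open>A zero coordinate would put \<open>z\<close> into the span of \<open>B - {b}\<close>,
  which by genericity would be everything, contradicting independence.\<close>

lemma generic_rep_nonzero:
  assumes "generic z" "B \<in> bases" "b \<in> B"
  shows "representation B z b \<noteq> 0"
proof
  assume 0: "representation B z b = 0"
  note B = basesD[OF assms(2)]
  have "z = (\<Sum>b\<in>B - {b}. representation B z b *\<^sub>R b)"
    using sum_rep[OF assms(2), of z] 0 B assms(3) by (simp add: sum.remove[of B b])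
  also have "\<dots> \<in> span (B - {b})"
    by (intro span_sum span_scale span_base)
  finally have "span (B - {b}) = UNIV"
    using assms(1) B(1) unfolding generic_def by blast
  then show False
    using B(2) assms(3) unfolding dependent_def by blast
qed

text \<open>Caratheodory's theorem in the hyperplane of height one gives few enough generators;
  genericity makes them span, hence a basis, and makes the nonnegative coordinates positive.\<close>

lemma generic_in_pos_hull_basis:
  assumes "z \<in> pos_hull" "generic z"
  shows "\<exists>B\<in>bases. \<forall>b\<in>B. 0 < representation B z b"
proof -
  obtain c where c: "\<And>v. v \<in> V \<Longrightarrow> 0 \<le> c v" "z = (\<Sum>v\<in>V. c v *\<^sub>R v)"
    using assms(1) unfolding pos_hull_def by auto
  \<comment> \<open>The height of \<open>z\<close>; dividing by it yields a convex
    combination.\<close>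
  define t where "t = sum c V"
  have "t \<noteq> 0"
  proof
    assume "t = 0"
    then have "\<forall>v\<in>V. c v = 0"
      using c(1) finite_V by (simp add: t_def sum_nonneg_eq_0_iff)
    then show False using c(2) generic_nonzero[OF assms(2)] by simp
  qed
  then have t: "t > 0" using c(1) by (simp add: t_def less_le sum_nonneg)
  have "(1 / t) *\<^sub>R z \<in> convex hull V"
    unfolding convex_hull_finite[OF finite_V] mem_Collect_eq using c t
    by (intro exI[of _ "\<lambda>v. c v / t"])
      (auto simp: scaleR_sum_right sum_divide_distrib[symmetric] t_def)
  then obtain S where S: "finite S" "S \<subseteq> V" "card S \<le> aff_dim V + 1" "(1 / t) *\<^sub>R z \<in> convex hull S"
    using caratheodory_aff_dim[of V] by blast
  obtain u where u: "\<And>v. v \<in> S \<Longrightarrow> 0 \<le> u v" "(\<Sum>v\<in>S. u v *\<^sub>R v) = (1 / t) *\<^sub>R z"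
    using S(4) convex_hull_finite[OF S(1)] by auto
  have z: "z = (\<Sum>v\<in>S. (t * u v) *\<^sub>R v)"
    using arg_cong[OF u(2), of "scaleR t"] t by (simp add: scaleR_sum_right)
  have "z \<in> span S" unfolding z by (intro span_sum span_scale span_base)
  then have span: "span S = UNIV" using assms(2) S(2) unfolding generic_def by blast
  have "V \<noteq> {}" using \<open>t \<noteq> 0\<close> by (auto simp: t_def)
  then have "a \<noteq> 0" using height_V by fastforce
  \<comment> \<open>Lying in a hyperplane lowers the Caratheodory bound to \<open>DIM('a)\<close>,
    and a spanning set of at most that size is independent.\<close>
  have "aff_dim V \<le> aff_dim {x. a \<bullet> x = 1}"
    by (intro aff_dim_subset) (use height_V in auto)
  then have "card S \<le> DIM('a)" using S(3) \<open>a \<noteq> 0\<close> by simp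
  then have "independent S"
    using card_le_dim_spanning[of S UNIV] span S(1) by simp
  then have B: "S \<in> bases" using S span by (simp add: bases_def)
  have "0 < representation S z b" if "b \<in> S" for b
    using generic_rep_nonzero[OF assms(2) B that] rep_sum[OF B that, of "\<lambda>v. t * u v"] u(1)[OF that] t
    unfolding z[symmetric] by (simp add: less_le)
  then show ?thesis using B by blast
qed

section \<open>Regular triangulation by a generic linear program\<close>

text \<open>For a basis \<open>B\<close>, this is the linear functional that agrees with
  \<open>w\<close> on \<open>B\<close>, evaluated at \<open>x\<close>.\<close>

definition cost :: "('a \<Rightarrow> real) \<Rightarrow> 'a set \<Rightarrow> 'a \<Rightarrow> real" where
  "cost w B x = (\<Sum>b\<in>B. representation B x b * w b)"

definition generic_weight :: "('a \<Rightarrow> real) \<Rightarrow> bool" where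
  "generic_weight w \<longleftrightarrow> (\<forall>B\<in>bases. \<forall>u\<in>V - B. cost w B u \<noteq> w u)"

text \<open>Bases with positive reduced costs. For generic \<open>w\<close> they are the lower
  facets of the vectors lifted by \<open>w\<close>, that is, the maximal cells of a regular
  triangulation.\<close>

definition cells :: "('a \<Rightarrow> real) \<Rightarrow> 'a set set" where
  "cells w = {B \<in> bases. \<forall>u\<in>V - B. cost w B u < w u}"

text \<open>Take \<open>w v = r ^ i v\<close> with \<open>i\<close> injective. Each forbidden
  equality says that \<open>r\<close> is a root of \<open>p B u\<close>, a nonzero polynomial since
  its coefficient at \<open>i u\<close> is 1; finitely many roots are excluded.\<close>

lemma exists_generic_weight: "\<exists>w. generic_weight w"
proof -
  obtain i :: "'a \<Rightarrow> nat" where i: "inj_on i V"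
    using finite_imp_inj_to_nat_seg[OF finite_V] by metis
  define p where "p B u = monom 1 (i u) - (\<Sum>b\<in>B. monom (representation B u b) (i b))" for B u
  have "coeff (p B u) (i u) = 1" if "B \<in> bases" "u \<in> V - B" for B u
  proof -
    have "i b \<noteq> i u" if "b \<in> B" for b
      using \<open>u \<in> V - B\<close> basesD(1)[OF \<open>B \<in> bases\<close>] that inj_onD[OF i] by blast
    then show ?thesis by (simp add: p_def coeff_sum)
  qed
  then have "p B u \<noteq> 0" if "B \<in> bases" "u \<in> V - B" for B u
    using that by fastforce
  then have "finite (\<Union>B\<in>bases. \<Union>u\<in>V - B. {r. poly (p B u) r = 0})"
    using finite_bases finite_V by (intro finite_UN_I poly_roots_finite) auto
  then obtain r where r: "r \<notin> (\<Union>B\<in>bases. \<Union>u\<in>V - B. {r. poly (p B u) r = 0})"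
    using ex_new_if_finite[OF infinite_UNIV_char_0] by blast
  have poly: "poly (p B u) r = r ^ i u - cost (\<lambda>v. r ^ i v) B u" for B u
    by (simp add: p_def cost_def poly_sum poly_monom)
  have "generic_weight (\<lambda>v. r ^ i v)"
    unfolding generic_weight_def
  proof (intro ballI notI)
    fix B u assume Bu: "B \<in> bases" "u \<in> V - B" "cost (\<lambda>v. r ^ i v) B u = r ^ i u"
    then have "poly (p B u) r = 0" by (simp add: poly)
    then show False using r Bu by blast
  qed
  then show ?thesis by blast
qed

text \<open>A simplex step: \<open>u\<close>, having negative reduced cost, enters the basis, and
  the vector \<open>b0\<close> chosen by the ratio test leaves.\<close>

lemma pivot:
  assumes B: "B \<in> bases" and z: "generic z" "\<And>b. b \<in> B \<Longrightarrow> 0 < representation B z b"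
    and u: "u \<in> V" "u \<notin> B" "w u < cost w B u"
  shows "\<exists>B'\<in>bases. (\<forall>b\<in>B'. 0 < representation B' z b) \<and> cost w B' z < cost w B z"
proof -
  define c l where "c = representation B u" and "l = representation B z"
  note BD = basesD[OF B]
  define P where "P = {b \<in> B. 0 < c b}"
  \<comment> \<open>All generators have height one, so some coordinate of \<open>u\<close> is
    positive and the ratio test ranges over a nonempty set.\<close>
  have "sum c B = 1" using height_rep[OF B, of u] height_V[OF u(1)] by (simp add: c_def)
  then have "\<not> (\<forall>b\<in>B. c b \<le> 0)" using sum_nonpos[of B c] by auto
  then have "finite P" "P \<noteq> {}" using BD(4) by (auto simp: P_def)
  then obtain b0 where b0: "b0 \<in> P" "\<And>b. b \<in> P \<Longrightarrow> l b0 / c b0 \<le> l b / c b"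
    using arg_min_if_finite(1)[of P "\<lambda>b. l b / c b"] arg_min_least[of P _ "\<lambda>b. l b / c b"] by metis
  \<comment> \<open>The largest multiple of \<open>u\<close> that can be subtracted from
    \<open>z\<close> keeping all coordinates in \<open>B\<close> nonnegative.\<close>
  define t where "t = l b0 / c b0"
  have t: "t > 0" using b0(1) z(2) by (auto simp: t_def P_def l_def)
  have ge: "0 \<le> l b - t * c b" if "b \<in> B" for b
  proof (cases "c b > 0")
    case True
    then have "t \<le> l b / c b" using b0(2) that by (simp add: P_def t_def)
    then show ?thesis using True by (simp add: field_simps)
  next
    case False
    then have "t * c b \<le> 0" using t by (simp add: mult_nonneg_nonpos)
    then show ?thesis using z(2)[OF that] by (simp add: l_def)
  qed
  have b0': "b0 \<in> B" "c b0 > 0" "l b0 - t * c b0 = 0" using b0(1) by (auto simp: P_def t_def)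
  define B' where "B' = insert u (B - {b0})"
  have usum: "(\<Sum>b\<in>B. c b *\<^sub>R b) = u" and zsum: "(\<Sum>b\<in>B. l b *\<^sub>R b) = z"
    by (simp_all add: c_def l_def sum_rep[OF B])
  have "c b0 *\<^sub>R b0 = u - (\<Sum>b\<in>B - {b0}. c b *\<^sub>R b)"
    using usum BD(4) b0'(1) by (simp add: sum.remove[of B b0] algebra_simps)
  also have "\<dots> \<in> span B'"
    by (intro span_diff span_sum span_scale) (auto intro: span_base simp: B'_def)
  finally have "(1 / c b0) *\<^sub>R (c b0 *\<^sub>R b0) \<in> span B'" by (rule span_scale)
  then have "b0 \<in> span B'" using b0'(2) by simp
  then have "B \<subseteq> span B'" by (auto simp: B'_def intro: span_base)
  then have span: "span B' = UNIV" using BD(3) span_minimal[OF _ subspace_span, of B B'] by auto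
  have fin': "finite B'" using BD(4) by (simp add: B'_def)
  have "card B' = DIM('a)"
    using BD(4,5) b0'(1) u(2) by (simp add: B'_def card_gt_0_iff)
  then have "independent B'" using card_le_dim_spanning[of B' UNIV] span fin' by simp
  then have B': "B' \<in> bases"
    using span BD(1) u(1) by (auto simp: bases_def B'_def)
  \<comment> \<open>The coordinates of \<open>z\<close> in \<open>B'\<close>, read off from
    \<open>z = t *\<^sub>R u + (z - t *\<^sub>R u)\<close>; the coefficient of \<open>b0\<close> in
    the second summand is 0.\<close>
  define m where "m b = (if b = u then t else l b - t * c b)" for b
  have m_sum: "(\<Sum>b\<in>B'. m b *\<^sub>R b) = t *\<^sub>R u + (\<Sum>b\<in>B. (l b - t * c b) *\<^sub>R b)"
  proof -
    have "(\<Sum>b\<in>B'. m b *\<^sub>R b) = t *\<^sub>R u + (\<Sum>b\<in>B - {b0}. m b *\<^sub>R b)"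
      using u(2) BD(4) by (simp add: B'_def m_def)
    also have "(\<Sum>b\<in>B - {b0}. m b *\<^sub>R b) = (\<Sum>b\<in>B - {b0}. (l b - t * c b) *\<^sub>R b)"
      by (intro sum.cong) (use u(2) in \<open>auto simp: m_def\<close>)
    also have "\<dots> = (\<Sum>b\<in>B. (l b - t * c b) *\<^sub>R b)"
      using b0' BD(4) by (intro sum.mono_neutral_left) auto
    finally show ?thesis .
  qed
  also have "(\<Sum>b\<in>B. (l b - t * c b) *\<^sub>R b) = z - t *\<^sub>R u"
    by (subst usum[symmetric], subst zsum[symmetric])
      (simp add: scaleR_diff_left sum_subtractf scaleR_sum_right)
  finally have zm: "(\<Sum>b\<in>B'. m b *\<^sub>R b) = z" by simp
  have rep': "representation B' z b = m b" if "b \<in> B'" for b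
    using rep_sum[OF B' that, of m] by (simp add: zm)
  \<comment> \<open>The ratio test gives nonnegativity; genericity of \<open>z\<close> excludes
    ties.\<close>
  have "0 < representation B' z b" if "b \<in> B'" for b
    using generic_rep_nonzero[OF z(1) B' that] rep'[OF that] ge[of b] that t
    by (auto simp: m_def B'_def less_le)
  moreover have "cost w B' z = (\<Sum>b\<in>B'. m b * w b)"
    unfolding cost_def by (intro sum.cong) (auto simp: rep')
  then have "cost w B' z = t * w u + (\<Sum>b\<in>B - {b0}. m b * w b)"
    using u(2) BD(4) by (simp add: B'_def m_def)
  moreover have "(\<Sum>b\<in>B - {b0}. m b * w b) = (\<Sum>b\<in>B - {b0}. (l b - t * c b) * w b)"
    by (intro sum.cong) (use u(2) in \<open>auto simp: m_def\<close>)
  moreover have "\<dots> = (\<Sum>b\<in>B. (l b - t * c b) * w b)"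
    using b0' BD(4) by (intro sum.mono_neutral_left) auto
  moreover have "\<dots> = cost w B z - t * cost w B u"
    by (simp add: cost_def l_def c_def sum_subtractf sum_distrib_left algebra_simps)
  moreover have "t * w u < t * cost w B u" using t u(3) by simp
  ultimately show ?thesis using B' by (intro bexI[of _ B']) auto
qed

text \<open>Among the finitely many bases whose open cone contains \<open>z\<close>, one of least
  cost admits no pivot; \<open>generic_weight\<close> turns this into strict inequalities.\<close>

lemma exists_cell:
  assumes "generic_weight w" "generic z" "z \<in> pos_hull"
  shows "\<exists>B\<in>cells w. \<forall>b\<in>B. 0 < representation B z b"
proof -
  define S where "S = {B \<in> bases. \<forall>b\<in>B. 0 < representation B z b}"
  have "finite S" "S \<noteq> {}"
    using finite_bases generic_in_pos_hull_basis[OF assms(3,2)] by (auto simp: S_def)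
  then obtain B where B: "B \<in> S" "\<And>B'. B' \<in> S \<Longrightarrow> cost w B z \<le> cost w B' z"
    using arg_min_if_finite(1)[of S "\<lambda>B. cost w B z"] arg_min_least[of S _ "\<lambda>B. cost w B z"] by metis
  have "cost w B u < w u" if u: "u \<in> V - B" for u
  proof (rule ccontr)
    assume "\<not> cost w B u < w u"
    then have "w u < cost w B u"
      using assms(1) B(1) u unfolding generic_weight_def S_def by force
    then obtain B' where "B' \<in> S" "cost w B' z < cost w B z"
      using pivot[of B z u w] B(1) assms(2) u by (auto simp: S_def)
    then show False using B(2) by force
  qed
  then show ?thesis using B(1) by (auto simp: cells_def S_def)
qed

lemma cost_sum:
  assumes "B \<in> bases"
  shows "cost w B (\<Sum>v\<in>F. c v *\<^sub>R v) = (\<Sum>v\<in>F. c v * cost w B v)"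
proof -
  have "linear (cost w B)"
    by (rule linearI)
      (simp_all add: cost_def rep_add rep_scaleR assms algebra_simps sum.distrib sum_distrib_left)
  then show ?thesis by (simp add: linear_sum linear_scale)
qed

lemma cost_base: "B \<in> bases \<Longrightarrow> b \<in> B \<Longrightarrow> cost w B b = w b"
  using basesD[of B] by (simp add: cost_def representation_basis if_distrib[of "\<lambda>x. x * _"] cong: if_cong)

text \<open>Weak duality: \<open>cost w B\<close> is a linear functional below \<open>w\<close> on \<open>V\<close>, with equality
  exactly on \<open>B\<close>; two cells containing the same generic point must both attain the optimum.\<close>

lemma generic_point_cell_unique:
  assumes B: "B \<in> cells w" "B' \<in> cells w"
    and pos: "\<And>b. b \<in> B \<Longrightarrow> 0 < representation B z b" "\<And>b. b \<in> B' \<Longrightarrow> 0 < representation B' z b"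
  shows "B = B'"
proof -
  have in_bases: "B \<in> bases" if "B \<in> cells w" for B using that by (simp add: cells_def)
  have cost_le: "cost w B v \<le> w v" if "B \<in> cells w" "v \<in> V" for B v
    using that by (cases "v \<in> B") (auto simp: cost_base cells_def intro: less_imp_le)
  have le: "cost w B z \<le> cost w B' z"
    if "B \<in> cells w" "B' \<in> cells w" "\<And>b. b \<in> B' \<Longrightarrow> 0 < representation B' z b" for B B'
  proof -
    have "cost w B z = (\<Sum>b\<in>B'. representation B' z b * cost w B b)"
      using cost_sum[OF in_bases[OF that(1)], of w "representation B' z" B'] by (simp add: sum_rep in_bases that)
    also have "\<dots> \<le> (\<Sum>b\<in>B'. representation B' z b * w b)"
      using that basesD(1)[OF in_bases[OF that(2)]]
      by (intro sum_mono mult_left_mono cost_le) (auto intro: less_imp_le)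
    finally show ?thesis by (simp add: cost_def)
  qed
  have sub: "B' \<subseteq> B" if B: "B \<in> cells w" "B' \<in> cells w" and eq: "cost w B z = cost w B' z"
    and pos: "\<And>b. b \<in> B' \<Longrightarrow> 0 < representation B' z b" for B B'
  proof
    fix b assume "b \<in> B'"
    note B'D = basesD[OF in_bases[OF B(2)]]
    show "b \<in> B"
    proof (rule ccontr)
      assume "b \<notin> B"
      then have "cost w B b < w b" using B(1) \<open>b \<in> B'\<close> B'D(1) by (auto simp: cells_def)
      then have "(\<Sum>b\<in>B'. representation B' z b * cost w B b) < (\<Sum>b\<in>B'. representation B' z b * w b)"
        using B'D B(1) pos \<open>b \<in> B'\<close>
        by (intro sum_strict_mono_ex1) (auto intro!: mult_left_mono cost_le intro: less_imp_le)
      then show False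
        using cost_sum[OF in_bases[OF B(1)], of w "representation B' z" B'] eq
        by (simp add: sum_rep in_bases B cost_def)
    qed
  qed
  have "cost w B z = cost w B' z" using le[of B B'] le[of B' B] B pos by simp
  then show ?thesis using sub[of B B'] sub[of B' B] B pos by auto
qed

section \<open>Half-open cones and the partition they form\<close>

text \<open>The facet opposite \<open>b\<close> is removed exactly when \<open>q\<close> lies
  strictly on its far side. For generic \<open>q\<close> the points kept are those that a small
  shift along \<open>q\<close> moves into the open cone.\<close>

definition half_open_cone :: "'a \<Rightarrow> 'a set \<Rightarrow> 'a set" where
  "half_open_cone q B = {x. \<forall>b\<in>B. 0 \<le> representation B x b \<and> (representation B q b < 0 \<longrightarrow> 0 < representation B x b)}"

text \<open>A line in direction \<open>q\<close> meets a proper span of vectors of \<open>V\<close>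
  at most once, as two meeting points would put \<open>q\<close> into that span.\<close>

lemma eventually_generic_shift:
  assumes "generic q"
  shows "eventually (\<lambda>\<epsilon>. generic (x + \<epsilon> *\<^sub>R q)) (at_right 0)"
proof -
  have "eventually (\<lambda>\<epsilon>. x + \<epsilon> *\<^sub>R q \<notin> span F) (at_right 0)" if F: "F \<subseteq> V" "span F \<noteq> UNIV" for F
  proof (cases "\<exists>r. x + r *\<^sub>R q \<in> span F")
    case True
    then obtain r where r: "x + r *\<^sub>R q \<in> span F" by blast
    have "\<epsilon> = r" if "x + \<epsilon> *\<^sub>R q \<in> span F" for \<epsilon>
    proof (rule ccontr)
      assume "\<epsilon> \<noteq> r"
      have "(\<epsilon> - r) *\<^sub>R q \<in> span F"
        using span_diff[OF that r] by (simp add: scaleR_diff_left)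
      then have "(1 / (\<epsilon> - r)) *\<^sub>R ((\<epsilon> - r) *\<^sub>R q) \<in> span F" by (rule span_scale)
      then have "q \<in> span F" using \<open>\<epsilon> \<noteq> r\<close> by simp
      then show False using assms F unfolding generic_def by blast
    qed
    then show ?thesis
      by (intro eventually_mono[OF eventually_neq_at_within[of r]]) auto
  qed simp
  then have "eventually (\<lambda>\<epsilon>. \<forall>F\<in>{F. F \<subseteq> V \<and> span F \<noteq> UNIV}. x + \<epsilon> *\<^sub>R q \<notin> span F) (at_right 0)"
    using finite_V by (intro eventually_ball_finite) auto
  then show ?thesis
    by (rule eventually_mono) (auto simp: generic_def)
qed

lemma eventually_rep_pos_iff:
  assumes "generic q" "B \<in> bases"
  shows "eventually (\<lambda>\<epsilon>. (\<forall>b\<in>B. 0 < representation B (x + \<epsilon> *\<^sub>R q) b) \<longleftrightarrow> x \<in> half_open_cone q B) (at_right 0)"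
proof -
  have "eventually (\<lambda>\<epsilon>. \<forall>b\<in>B. 0 < representation B (x + \<epsilon> *\<^sub>R q) b \<longleftrightarrow>
      0 \<le> representation B x b \<and> (representation B q b < 0 \<longrightarrow> 0 < representation B x b)) (at_right 0)"
    using basesD(4)[OF assms(2)]
    by (intro eventually_ball_finite)
      (auto simp: rep_add rep_scaleR assms generic_rep_nonzero intro!: eventually_shift_pos_iff)
  then show ?thesis
    by (rule eventually_mono) (auto simp: half_open_cone_def)
qed

text \<open>One sufficiently small shift moves \<open>x\<close> into both open cones, where
  \<open>generic_point_cell_unique\<close> applies.\<close>

lemma cell_unique:
  assumes "generic q" "B \<in> cells w" "B' \<in> cells w" "x \<in> half_open_cone q B" "x \<in> half_open_cone q B'"
  shows "B = B'"
proof -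
  have "eventually (\<lambda>\<epsilon>. (\<forall>b\<in>B. 0 < representation B (x + \<epsilon> *\<^sub>R q) b) \<and>
      (\<forall>b\<in>B'. 0 < representation B' (x + \<epsilon> *\<^sub>R q) b)) (at_right 0)"
    using eventually_rep_pos_iff[of q B x] eventually_rep_pos_iff[of q B' x] assms
    by (auto simp: cells_def elim: eventually_elim2)
  then obtain \<epsilon> where "\<forall>b\<in>B. 0 < representation B (x + \<epsilon> *\<^sub>R q) b"
      "\<forall>b\<in>B'. 0 < representation B' (x + \<epsilon> *\<^sub>R q) b"
    using eventually_happens'[of "at_right (0::real)"] by fastforce
  then show ?thesis using generic_point_cell_unique assms(2,3) by blast
qed

text \<open>For one small shift the point is generic and simultaneously decides membership in all
  finitely many half-open cones, so \<open>exists_cell\<close> carries over from generic points to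
  arbitrary ones.\<close>

lemma cell_iff:
  assumes "generic q" "generic_weight w"
  shows "(\<exists>B\<in>cells w. x \<in> half_open_cone q B) \<longleftrightarrow> eventually (\<lambda>\<epsilon>. x + \<epsilon> *\<^sub>R q \<in> pos_hull) (at_right 0)"
proof
  assume "\<exists>B\<in>cells w. x \<in> half_open_cone q B"
  then obtain B where B: "B \<in> bases" "x \<in> half_open_cone q B" by (auto simp: cells_def)
  have "eventually (\<lambda>\<epsilon>. \<forall>b\<in>B. 0 < representation B (x + \<epsilon> *\<^sub>R q) b) (at_right 0)"
    using eventually_rep_pos_iff[OF assms(1) B(1), of x] B(2) by (auto elim: eventually_mono)
  then show "eventually (\<lambda>\<epsilon>. x + \<epsilon> *\<^sub>R q \<in> pos_hull) (at_right 0)"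
    by (rule eventually_mono) (auto intro!: rep_nonneg_in_pos_hull[OF B(1)] less_imp_le)
next
  assume ev: "eventually (\<lambda>\<epsilon>. x + \<epsilon> *\<^sub>R q \<in> pos_hull) (at_right 0)"
  have "eventually (\<lambda>\<epsilon>. \<forall>B\<in>bases. (\<forall>b\<in>B. 0 < representation B (x + \<epsilon> *\<^sub>R q) b) \<longleftrightarrow> x \<in> half_open_cone q B) (at_right 0)"
    using finite_bases by (intro eventually_ball_finite ballI eventually_rep_pos_iff assms)
  with ev eventually_generic_shift[OF assms(1), of x]
  have "eventually (\<lambda>\<epsilon>. x + \<epsilon> *\<^sub>R q \<in> pos_hull \<and> generic (x + \<epsilon> *\<^sub>R q) \<and>
      (\<forall>B\<in>bases. (\<forall>b\<in>B. 0 < representation B (x + \<epsilon> *\<^sub>R q) b) \<longleftrightarrow> x \<in> half_open_cone q B)) (at_right 0)"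
    by eventually_elim blast
  then obtain \<epsilon> where \<epsilon>: "x + \<epsilon> *\<^sub>R q \<in> pos_hull" "generic (x + \<epsilon> *\<^sub>R q)"
      "\<forall>B\<in>bases. (\<forall>b\<in>B. 0 < representation B (x + \<epsilon> *\<^sub>R q) b) \<longleftrightarrow> x \<in> half_open_cone q B"
    using eventually_happens'[OF trivial_limit_at_right_real] by blast
  then show "\<exists>B\<in>cells w. x \<in> half_open_cone q B"
    using exists_cell[OF assms(2)] unfolding cells_def by blast
qed

text \<open>From left to right this is a closedness property of the cone; it follows from the
  partition, since half-open cones have nonnegative coordinates.\<close>

lemma eventually_shift_in_pos_hull_iff:
  assumes "generic q" "q \<in> pos_hull"
  shows "eventually (\<lambda>\<epsilon>. x + \<epsilon> *\<^sub>R q \<in> pos_hull) (at_right 0) \<longleftrightarrow> x \<in> pos_hull"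
proof
  assume "eventually (\<lambda>\<epsilon>. x + \<epsilon> *\<^sub>R q \<in> pos_hull) (at_right 0)"
  moreover obtain w where "generic_weight w" using exists_generic_weight by blast
  ultimately obtain B where "B \<in> bases" "x \<in> half_open_cone q B"
    using cell_iff[OF assms(1), of w x] by (auto simp: cells_def)
  then show "x \<in> pos_hull" by (intro rep_nonneg_in_pos_hull[of B]) (auto simp: half_open_cone_def)
next
  assume "x \<in> pos_hull"
  then show "eventually (\<lambda>\<epsilon>. x + \<epsilon> *\<^sub>R q \<in> pos_hull) (at_right 0)"
    by (intro eventually_mono[OF eventually_at_right_less[of "0::real"]]) (auto intro!: pos_hull_add pos_hull_scaleR assms)
qed

text \<open>Finitely many proper subspaces form a null set, which no nonempty open set is.\<close>

lemma open_contains_generic: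
  assumes "open U" "U \<noteq> {}"
  obtains q where "q \<in> U" "generic q"
proof -
  have "negligible (\<Union>F\<in>{F. F \<subseteq> V \<and> span F \<noteq> UNIV}. span F)"
  proof (rule negligible_Union)
    show "finite (span ` {F. F \<subseteq> V \<and> span F \<noteq> UNIV})" using finite_V by simp
    fix S assume "S \<in> span ` {F. F \<subseteq> V \<and> span F \<noteq> UNIV}"
    then obtain F where F: "S = span F" "span F \<noteq> UNIV" by blast
    then have "dim S < DIM('a)"
      using dim_subset_UNIV[of F] dim_eq_full[of F] by simp
    then show "negligible S" by (rule negligible_lowdim)
  qed
  then obtain q where "q \<in> U" "q \<notin> (\<Union>F\<in>{F. F \<subseteq> V \<and> span F \<noteq> UNIV}. span F)"
    using open_not_negligible[OF assms] negligible_subset by blast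
  then show thesis using that unfolding generic_def by blast
qed

end

section \<open>Lattice points of the half-open cones\<close>

text \<open>Vanishing off \<open>B\<close> makes \<open>m\<close> determined by its values on
  \<open>B\<close>, so these functions can be counted.\<close>

definition compositions :: "'a set \<Rightarrow> nat \<Rightarrow> ('a \<Rightarrow> nat) set" where
  "compositions B N = {m. (\<forall>b. b \<notin> B \<longrightarrow> m b = 0) \<and> sum m B = N}"

lemma compositions_insert:
  assumes "finite B" "b \<notin> B"
  shows "compositions (insert b B) N = (\<Union>k\<le>N. (\<lambda>m. m(b := k)) ` compositions B (N - k))"
proof (intro equalityI subsetI)
  fix m assume m: "m \<in> compositions (insert b B) N"
  have "sum (m(b := 0)) B = sum m B"
    by (intro sum.cong) (use assms in auto)
  then have "m(b := 0) \<in> compositions B (N - m b)" "m b \<le> N" "m = (m(b := 0))(b := m b)"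
    using m assms by (auto simp: compositions_def)
  then show "m \<in> (\<Union>k\<le>N. (\<lambda>m. m(b := k)) ` compositions B (N - k))"
    by (intro UN_I[of "m b"] image_eqI[of _ _ "m(b := 0)"]) auto
next
  fix m assume "m \<in> (\<Union>k\<le>N. (\<lambda>m. m(b := k)) ` compositions B (N - k))"
  then obtain k m' where m: "k \<le> N" "m' \<in> compositions B (N - k)" "m = m'(b := k)" by blast
  have "sum (m'(b := k)) B = sum m' B"
    by (intro sum.cong) (use assms in auto)
  then show "m \<in> compositions (insert b B) N"
    using m assms by (auto simp: compositions_def)
qed

text \<open>Stars and bars, by splitting on the value at one element and summing with the
  hockey-stick identity \<open>choose_rising_sum\<close>.\<close>

lemma card_compositions:
  assumes "finite B" "B \<noteq> {}"
  shows "finite (compositions B N) \<and> card (compositions B N) = (N + card B - 1) choose (card B - 1)"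
  using assms
proof (induction B arbitrary: N rule: finite_ne_induct)
  case (singleton b)
  have "compositions {b} N = {(\<lambda>_. 0)(b := N)}"
    by (auto simp: compositions_def fun_eq_iff)
  then show ?case by simp
next
  case (insert b B)
  have inj: "inj_on (\<lambda>m. m(b := k)) (compositions B M)" for k M
  proof (rule inj_onI)
    fix m m' assume m: "m \<in> compositions B M" "m' \<in> compositions B M" and eq: "m(b := k) = m'(b := k)"
    have "m x = m' x" for x
      using m fun_cong[OF eq, of x] insert.hyps by (cases "x = b") (auto simp: compositions_def)
    then show "m = m'" by blast
  qed
  define n where "n = card B - 1"
  have n: "card B = Suc n" using insert.hyps by (simp add: n_def card_gt_0_iff)
  have "card (compositions (insert b B) N) = (\<Sum>k\<le>N. card ((\<lambda>m. m(b := k)) ` compositions B (N - k)))"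
    unfolding compositions_insert[OF insert.hyps(1,3)]
  proof (rule card_UN_disjoint)
    show "\<forall>k\<in>{..N}. \<forall>l\<in>{..N}. k \<noteq> l \<longrightarrow>
        (\<lambda>m. m(b := k)) ` compositions B (N - k) \<inter> (\<lambda>m. m(b := l)) ` compositions B (N - l) = {}"
      by (auto dest: fun_upd_eqD)
  qed (use insert.IH in auto)
  also have "\<dots> = (\<Sum>k\<le>N. (n + (N - k)) choose n)"
    by (intro sum.cong) (auto simp: card_image[OF inj] insert.IH n add_ac)
  also have "\<dots> = (\<Sum>j\<le>N. (n + j) choose n)"
    by (rule sum.reindex_bij_witness[where i = "\<lambda>k. N - k" and j = "\<lambda>k. N - k"]) auto
  also have "\<dots> = (n + N + 1) choose (n + 1)" by (rule choose_rising_sum)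
  finally have "card (compositions (insert b B) N) = (N + card (insert b B) - 1) choose (card (insert b B) - 1)"
    using insert.hyps n by (simp add: add_ac)
  moreover have "finite (compositions (insert b B) N)"
    unfolding compositions_insert[OF insert.hyps(1,3)] using insert.IH by blast
  ultimately show ?case by blast
qed

section \<open>Box points, their heights and reciprocity\<close>

text \<open>\<open>\<Lambda>\<close> is a discrete subgroup containing the generators, with integral
  heights.\<close>

locale homogenized_lattice = homogenized +
  fixes \<Lambda> :: "'a set"
  assumes V_lattice: "V \<subseteq> \<Lambda>"
    and lattice_diff: "x \<in> \<Lambda> \<Longrightarrow> y \<in> \<Lambda> \<Longrightarrow> x - y \<in> \<Lambda>"
    and finite_lattice: "finite {x \<in> \<Lambda>. norm x \<le> r}"
    and height_lattice: "x \<in> \<Lambda> \<Longrightarrow> a \<bullet> x \<in> \<int>"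
    and zero_lattice: "0 \<in> \<Lambda>"
begin

lemma lattice_add: "x \<in> \<Lambda> \<Longrightarrow> y \<in> \<Lambda> \<Longrightarrow> x + y \<in> \<Lambda>"
  using lattice_diff[of x "0 - y"] lattice_diff[of 0 y] zero_lattice by simp

lemma lattice_sum:
  assumes "finite F" "F \<subseteq> \<Lambda>"
  shows "(\<Sum>b\<in>F. real (m b) *\<^sub>R b) \<in> \<Lambda>"
proof -
  have scale: "real k *\<^sub>R x \<in> \<Lambda>" if "x \<in> \<Lambda>" for k x
    by (induction k) (auto simp: zero_lattice scaleR_add_left intro: lattice_add that)
  show ?thesis using assms
    by (induction F rule: finite_induct) (auto simp: zero_lattice intro!: lattice_add scale)
qed

text \<open>The lattice points of the fundamental parallelepiped that tiles
  \<open>half_open_cone q B\<close>: a removed facet turns \<open>[0,1)\<close> into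
  \<open>(0,1]\<close>.\<close>

definition half_open_box :: "'a \<Rightarrow> 'a set \<Rightarrow> 'a set" where
  "half_open_box q B = {x \<in> \<Lambda>. \<forall>b\<in>B. if 0 < representation B q b
     then 0 \<le> representation B x b \<and> representation B x b < 1
     else 0 < representation B x b \<and> representation B x b \<le> 1}"

definition hgt :: "'a \<Rightarrow> nat" where
  "hgt x = nat \<lfloor>a \<bullet> x\<rfloor>"

lemma half_open_box_bounds:
  assumes "x \<in> half_open_box q B" "b \<in> B"
  shows "0 \<le> representation B x b" "representation B x b \<le> 1"
  using assms by (auto simp: half_open_box_def split: if_splits)

lemma finite_half_open_box:
  assumes "B \<in> bases"
  shows "finite (half_open_box q B)"
proof (rule finite_subset[OF _ finite_lattice])
  have "norm x \<le> (\<Sum>b\<in>B. norm b)" if "x \<in> half_open_box q B" for x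
  proof -
    have "norm x = norm (\<Sum>b\<in>B. representation B x b *\<^sub>R b)" by (simp add: sum_rep assms)
    also have "\<dots> \<le> (\<Sum>b\<in>B. norm b)"
      by (intro sum_norm_le) (use half_open_box_bounds[OF that] in \<open>auto simp: mult_left_le_one_le\<close>)
    finally show ?thesis .
  qed
  then show "half_open_box q B \<subseteq> {x \<in> \<Lambda>. norm x \<le> (\<Sum>b\<in>B. norm b)}" by (auto simp: half_open_box_def)
qed

lemma height_half_open_box:
  assumes "B \<in> bases" "x \<in> half_open_box q B"
  shows "a \<bullet> x = real (hgt x)" "hgt x \<le> DIM('a)"
proof -
  have x: "x \<in> \<Lambda>" using assms(2) by (simp add: half_open_box_def)
  have "0 \<le> a \<bullet> x"
    unfolding height_rep[OF assms(1)] by (intro sum_nonneg) (use half_open_box_bounds assms in auto)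
  then show 1: "a \<bullet> x = real (hgt x)"
    using height_lattice[OF x] by (auto simp: hgt_def elim!: Ints_cases)
  have "a \<bullet> x \<le> (\<Sum>b\<in>B. 1)"
    unfolding height_rep[OF assms(1)] by (intro sum_mono) (use half_open_box_bounds assms in auto)
  then show "hgt x \<le> DIM('a)" using basesD(5)[OF assms(1)] 1 by simp
qed

text \<open>Rounding the coordinates splits a lattice point of the cone into a box point and a
  natural combination of generators; each generator used adds one to the height.\<close>

lemma half_open_cell_eq:
  assumes B: "B \<in> bases" and q: "generic q"
  shows "{x \<in> \<Lambda> \<inter> half_open_cone q B. a \<bullet> x = real n} =
    (\<lambda>(p, m). p + (\<Sum>b\<in>B. real (m b) *\<^sub>R b)) `
      (SIGMA p:{p \<in> half_open_box q B. hgt p \<le> n}. compositions B (n - hgt p))"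
    (is "?L = ?f ` ?S")
proof (intro equalityI subsetI)
  fix x assume "x \<in> ?L"
  then have x: "x \<in> \<Lambda>" "x \<in> half_open_cone q B" "a \<bullet> x = real n" by auto
  \<comment> \<open>Floor leaves a remainder in \<open>[0,1)\<close>, ceiling minus one a remainder
    in \<open>(0,1]\<close>. In the second case genericity makes the coordinate of \<open>q\<close>
    negative, so that of \<open>x\<close> is positive and \<open>nat\<close> truncates
    nothing.\<close>
  define m where "m b = (if b \<in> B then if 0 < representation B q b
    then nat \<lfloor>representation B x b\<rfloor> else nat (\<lceil>representation B x b\<rceil> - 1) else 0)" for b
  define p where "p = x - (\<Sum>b\<in>B. real (m b) *\<^sub>R b)"
  have rep: "representation B p b = representation B x b - real (m b)" if "b \<in> B" for b
    unfolding p_def using rep_sum[OF B that, of "\<lambda>b. real (m b)"] by (simp add: rep_diff B)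
  have "p \<in> \<Lambda>"
    unfolding p_def using x basesD(1,4)[OF B] V_lattice by (intro lattice_diff lattice_sum) auto
  moreover have "if 0 < representation B q b
      then 0 \<le> representation B p b \<and> representation B p b < 1
      else 0 < representation B p b \<and> representation B p b \<le> 1" if "b \<in> B" for b
  proof (cases "0 < representation B q b")
    case True
    have "0 \<le> representation B x b" using x(2) that by (simp add: half_open_cone_def)
    then show ?thesis using True that
      by (simp add: rep m_def) linarith
  next
    case False
    then have "representation B q b < 0" using generic_rep_nonzero[OF q B that] by simp
    then have "0 < representation B x b" using x(2) that by (simp add: half_open_cone_def)
    then show ?thesis using False that
      by (simp add: rep m_def) linarith
  qed
  ultimately have p: "p \<in> half_open_box q B" by (simp add: half_open_box_def)
  have "a \<bullet> x = a \<bullet> p + real (sum m B)"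
    using height_sum[of B "\<lambda>b. real (m b)"] basesD(1)[OF B]
    by (simp add: p_def inner_diff_right)
  then have "n = hgt p + sum m B" using x(3) height_half_open_box(1)[OF B p] by linarith
  then have "(p, m) \<in> ?S" using p by (simp add: compositions_def m_def)
  then show "x \<in> ?f ` ?S" by (rule rev_image_eqI) (simp add: p_def)
next
  fix x assume "x \<in> ?f ` ?S"
  then obtain p m where p: "p \<in> half_open_box q B" "hgt p \<le> n" and m: "sum m B = n - hgt p"
    and x: "x = p + (\<Sum>b\<in>B. real (m b) *\<^sub>R b)"
    by (auto simp: compositions_def)
  have rep: "representation B x b = representation B p b + real (m b)" if "b \<in> B" for b
    unfolding x using rep_sum[OF B that, of "\<lambda>b. real (m b)"] by (simp add: rep_add B)
  have "x \<in> \<Lambda>"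
    unfolding x using p basesD(1,4)[OF B] V_lattice
    by (intro lattice_add lattice_sum) (auto simp: half_open_box_def)
  moreover have "x \<in> half_open_cone q B"
    using p(1) by (force simp: half_open_cone_def half_open_box_def rep split: if_splits)
  moreover have "a \<bullet> x = real n"
    using height_sum[of B "\<lambda>b. real (m b)"] basesD(1)[OF B] height_half_open_box(1)[OF B p(1)] m p(2)
    by (simp add: x inner_add_right flip: of_nat_sum)
  ultimately show "x \<in> ?L" by simp
qed

text \<open>Coordinates of two box points differ by less than 1, so their integral parts
  \<open>m\<close> and \<open>m'\<close> must agree.\<close>

lemma half_open_cell_inj:
  assumes B: "B \<in> bases"
  shows "inj_on (\<lambda>(p, m). p + (\<Sum>b\<in>B. real (m b) *\<^sub>R b))
    (SIGMA p:{p \<in> half_open_box q B. hgt p \<le> n}. compositions B (n - hgt p))"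
proof (rule inj_onI, clarify)
  fix p m p' m'
  assume p: "p \<in> half_open_box q B" "p' \<in> half_open_box q B" and m: "m \<in> compositions B (n - hgt p)" "m' \<in> compositions B (n - hgt p')"
    and eq: "p + (\<Sum>b\<in>B. real (m b) *\<^sub>R b) = p' + (\<Sum>b\<in>B. real (m' b) *\<^sub>R b)"
  have "m b = m' b" for b
  proof (cases "b \<in> B")
    case True
    have "representation B p b + real (m b) = representation B p' b + real (m' b)"
      using arg_cong[OF eq, of "\<lambda>x. representation B x b"]
        rep_sum[OF B True, of "\<lambda>b. real (m b)"] rep_sum[OF B True, of "\<lambda>b. real (m' b)"]
      by (simp add: rep_add B)
    moreover have "\<bar>representation B p b - representation B p' b\<bar> < 1"
      using p True by (force simp: half_open_box_def split: if_splits)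
    ultimately show ?thesis by linarith
  qed (use m in \<open>auto simp: compositions_def\<close>)
  then have "m = m'" by blast
  then show "p = p' \<and> m = m'" using eq by simp
qed

lemma card_half_open_cell:
  assumes B: "B \<in> bases" and q: "generic q" and D: "DIM('a) = Suc d" "d \<ge> 1"
  shows "finite {x \<in> \<Lambda> \<inter> half_open_cone q B. a \<bullet> x = real n}"
    and "card {x \<in> \<Lambda> \<inter> half_open_cone q B. a \<bullet> x = real n} =
      (\<Sum>j\<le>Suc d. card {p \<in> half_open_box q B. hgt p = j} * ((n + d - j) choose d))"
proof -
  have B0: "finite B" "B \<noteq> {}" "card B = Suc d" using basesD[OF B] D by auto
  have fin: "finite {p \<in> half_open_box q B. hgt p \<le> n}" using finite_half_open_box[OF B, of q] by simp
  show "finite {x \<in> \<Lambda> \<inter> half_open_cone q B. a \<bullet> x = real n}"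
    unfolding half_open_cell_eq[OF B q] using fin card_compositions[OF B0(1,2)] by (intro finite_imageI finite_SigmaI) auto
  have "card {x \<in> \<Lambda> \<inter> half_open_cone q B. a \<bullet> x = real n} =
      (\<Sum>p\<in>{p \<in> half_open_box q B. hgt p \<le> n}. card (compositions B (n - hgt p)))"
    unfolding half_open_cell_eq[OF B q] card_image[OF half_open_cell_inj[OF B]]
    using fin card_compositions[OF B0(1,2)] by (intro card_SigmaI) auto
  \<comment> \<open>Box points higher than \<open>n\<close> may be added: their binomials vanish
    because \<open>d \<ge> 1\<close>.\<close>
  also have "\<dots> = (\<Sum>p\<in>half_open_box q B. (n + d - hgt p) choose d)"
    by (rule sum.mono_neutral_cong_left)
      (use finite_half_open_box[OF B, of q] card_compositions[OF B0(1,2)] B0(3) D(2) in auto)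
  also have "\<dots> = (\<Sum>j\<le>Suc d. \<Sum>p\<in>{p \<in> half_open_box q B. hgt p = j}. (n + d - hgt p) choose d)"
    by (rule sum.group[symmetric]) (use finite_half_open_box[OF B, of q] height_half_open_box(2)[OF B] D in auto)
  also have "\<dots> = (\<Sum>j\<le>Suc d. \<Sum>p\<in>{p \<in> half_open_box q B. hgt p = j}. (n + d - j) choose d)"
    by (intro sum.cong) auto
  also have "\<dots> = (\<Sum>j\<le>Suc d. card {p \<in> half_open_box q B. hgt p = j} * ((n + d - j) choose d))"
    by simp
  finally show "card {x \<in> \<Lambda> \<inter> half_open_cone q B. a \<bullet> x = real n} = \<dots>" .
qed

text \<open>Reciprocity on one cell: the point reflection \<open>p \<mapsto> (\<Sum>b\<in>B. b) - p\<close> exchanges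
  the facets kept and the facets removed.\<close>

lemma card_half_open_box_uminus:
  assumes B: "B \<in> bases" and q: "generic q" and j: "j \<le> DIM('a)"
  shows "card {p \<in> half_open_box (- q) B. hgt p = j} = card {p \<in> half_open_box q B. hgt p = DIM('a) - j}"
proof -
  define s where "s = (\<Sum>b\<in>B. b)"
  have s: "s = (\<Sum>b\<in>B. real 1 *\<^sub>R b)" by (simp add: s_def)
  have "s \<in> \<Lambda>" unfolding s by (intro lattice_sum) (use basesD[OF B] V_lattice in auto)
  have rep_s: "representation B s b = 1" if "b \<in> B" for b
    using rep_sum[OF B that, of "\<lambda>_. 1"] by (simp add: s_def)
  have hs: "a \<bullet> s = real DIM('a)"
    unfolding height_rep[OF B] using basesD(5)[OF B] by (simp add: rep_s)
  \<comment> \<open>Stated for every generic \<open>q\<close>, so that with \<open>- q\<close> it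
    also covers the inverse direction of the reflection.\<close>
  have box: "s - p \<in> half_open_box (- q) B" if "p \<in> half_open_box q B" "generic q" for p q
    using that \<open>s \<in> \<Lambda>\<close> generic_rep_nonzero[OF that(2) B]
    by (force simp: half_open_box_def rep_diff rep_uminus rep_s B intro!: lattice_diff split: if_splits)
  have h: "hgt (s - p) = DIM('a) - hgt p" if "p \<in> half_open_box q B" for p q
  proof -
    have "a \<bullet> (s - p) = real (DIM('a) - hgt p)"
      using height_half_open_box[OF B that] hs by (simp add: inner_diff_right)
    then show ?thesis by (simp add: hgt_def)
  qed
  have "bij_betw (\<lambda>p. s - p) {p \<in> half_open_box (- q) B. hgt p = j} {p \<in> half_open_box q B. hgt p = DIM('a) - j}"
  proof (rule bij_betwI[where g = "\<lambda>p. s - p"])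
    show "(\<lambda>p. s - p) \<in> {p \<in> half_open_box (- q) B. hgt p = j} \<rightarrow> {p \<in> half_open_box q B. hgt p = DIM('a) - j}"
      using box[of _ "- q"] h[of _ "- q"] q by (auto simp: generic_uminus)
    show "(\<lambda>p. s - p) \<in> {p \<in> half_open_box q B. hgt p = DIM('a) - j} \<rightarrow> {p \<in> half_open_box (- q) B. hgt p = j}"
      using box[of _ q] h[of _ q] q j by auto
  qed auto
  then show ?thesis by (rule bij_betw_same_card)
qed

text \<open>\<open>h j\<close> counts the box points of height \<open>j\<close> over all cells.
  Since \<open>cells w\<close> does not depend on \<open>q\<close>, the same triangulation serves
  both shifts, and reflecting the boxes reverses \<open>h\<close>.\<close>

theorem h_star_exists:
  assumes q: "generic q" and D: "DIM('a) = Suc d" "d \<ge> 1"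
  obtains h :: "nat \<Rightarrow> nat" where
    "\<And>n. card {x \<in> \<Lambda>. a \<bullet> x = real n \<and> eventually (\<lambda>\<epsilon>. x + \<epsilon> *\<^sub>R q \<in> pos_hull) (at_right 0)} =
      (\<Sum>j\<le>d+1. h j * ((n + d - j) choose d))"
    "\<And>n. card {x \<in> \<Lambda>. a \<bullet> x = real n \<and> eventually (\<lambda>\<epsilon>. x - \<epsilon> *\<^sub>R q \<in> pos_hull) (at_right 0)} =
      (\<Sum>j\<le>d+1. h (d + 1 - j) * ((n + d - j) choose d))"
proof -
  obtain w where w: "generic_weight w" using exists_generic_weight by blast
  define h where "h q j = (\<Sum>B\<in>cells w. card {p \<in> half_open_box q B. hgt p = j})" for q j
  have in_bases: "B \<in> bases" if "B \<in> cells w" for B using that by (simp add: cells_def)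
  then have finite_cells: "finite (cells w)" using finite_bases by (auto intro: finite_subset)
  have count: "card {x \<in> \<Lambda>. a \<bullet> x = real n \<and> eventually (\<lambda>\<epsilon>. x + \<epsilon> *\<^sub>R q \<in> pos_hull) (at_right 0)} =
      (\<Sum>j\<le>Suc d. h q j * ((n + d - j) choose d))" if q: "generic q" for q n
  proof -
    have "{x \<in> \<Lambda>. a \<bullet> x = real n \<and> eventually (\<lambda>\<epsilon>. x + \<epsilon> *\<^sub>R q \<in> pos_hull) (at_right 0)} =
        (\<Union>B\<in>cells w. {x \<in> \<Lambda> \<inter> half_open_cone q B. a \<bullet> x = real n})"
      using cell_iff[OF q w] by blast
    also have "card \<dots> = (\<Sum>B\<in>cells w. card {x \<in> \<Lambda> \<inter> half_open_cone q B. a \<bullet> x = real n})"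
      using finite_cells card_half_open_cell(1)[OF in_bases q D] cell_unique[OF q]
      by (intro card_UN_disjoint) blast+
    also have "\<dots> = (\<Sum>B\<in>cells w. \<Sum>j\<le>Suc d. card {p \<in> half_open_box q B. hgt p = j} * ((n + d - j) choose d))"
      by (intro sum.cong refl card_half_open_cell(2)[OF in_bases q D])
    also have "\<dots> = (\<Sum>j\<le>Suc d. h q j * ((n + d - j) choose d))"
      unfolding h_def sum_distrib_right by (rule sum.swap)
    finally show ?thesis .
  qed
  have "h (- q) j = h q (d + 1 - j)" if "j \<le> d + 1" for j
    unfolding h_def using that D by (intro sum.cong) (auto simp: card_half_open_box_uminus[OF in_bases q])
  then have "(\<Sum>j\<le>d+1. h (- q) j * ((n + d - j) choose d)) =
      (\<Sum>j\<le>d+1. h q (d + 1 - j) * ((n + d - j) choose d))" for n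
    by (intro sum.cong) auto
  then show thesis
    using that[of "h q"] count[OF q] count[of "- q"] q by (simp add: generic_uminus del: sum.atMost_Suc)
qed

end

section \<open>Lattice polytopes\<close>

lemma finite_bounded_int_lattice: "finite {x \<in> int_lattice :: (real ^ 'd) set. norm x \<le> r}"
proof -
  have "{x \<in> int_lattice :: (real ^ 'd) set. norm x \<le> r} \<subseteq>
      vec_lambda ` (UNIV \<rightarrow>\<^sub>E {t. t \<in> \<int> \<and> \<bar>t\<bar> \<le> r})"
  proof
    fix x :: "real ^ 'd" assume "x \<in> {x \<in> int_lattice. norm x \<le> r}"
    then have "x = vec_lambda (($) x)" "($) x \<in> UNIV \<rightarrow>\<^sub>E {t. t \<in> \<int> \<and> \<bar>t\<bar> \<le> r}"
      using order_trans[OF component_le_norm_cart] by (auto simp: int_lattice_def)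
    then show "x \<in> vec_lambda ` (UNIV \<rightarrow>\<^sub>E {t. t \<in> \<int> \<and> \<bar>t\<bar> \<le> r})" by blast
  qed
  then show ?thesis
    by (rule finite_subset) (auto intro!: finite_PiE finite_abs_int_segment)
qed

lemma homogenized_lattice_lift:
  fixes W :: "(real ^ 'd) set"
  assumes "finite W" "W \<subseteq> int_lattice"
  shows "homogenized_lattice ((\<lambda>w. (w, 1 :: real)) ` W) (0, 1) (int_lattice \<times> \<int>)"
proof
  fix r
  have "{x \<in> int_lattice \<times> \<int>. norm x \<le> r} \<subseteq>
      {x \<in> int_lattice :: (real ^ 'd) set. norm x \<le> r} \<times> {t. t \<in> \<int> \<and> \<bar>t\<bar> \<le> r}"
    using order_trans[OF norm_fst_le] order_trans[OF norm_snd_le] by fastforce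
  then show "finite {x \<in> (int_lattice :: (real ^ 'd) set) \<times> (\<int> :: real set). norm x \<le> r}"
    by (rule finite_subset) (auto intro!: finite_bounded_int_lattice finite_abs_int_segment)
next
  fix x y :: "(real ^ 'd) \<times> real"
  assume "x \<in> int_lattice \<times> \<int>" "y \<in> int_lattice \<times> \<int>"
  then show "x - y \<in> int_lattice \<times> \<int>" by (auto simp: int_lattice_def)
qed (use assms in \<open>auto simp: int_lattice_def zero_prod_def\<close>)

section \<open>The cone over a full-dimensional lattice polytope\<close>

locale lattice_polytope_cone =
  fixes W :: "(real ^ 'd) set" and P :: "(real ^ 'd) set"
  assumes W: "finite W" "W \<subseteq> int_lattice" and P: "P = convex hull W" "interior P \<noteq> {}"
begin

sublocale homogenized_lattice "(\<lambda>w. (w, 1 :: real)) ` W" "(0, 1)" "int_lattice \<times> \<int>"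
  by (rule homogenized_lattice_lift) (fact W)+

lemma sum_lift:
  "(\<Sum>v\<in>(\<lambda>w. (w, 1 :: real)) ` W. c v *\<^sub>R v) = (\<Sum>w\<in>W. c (w, 1) *\<^sub>R w, \<Sum>w\<in>W. c (w, 1))"
proof -
  have "(\<Sum>v\<in>(\<lambda>w. (w, 1 :: real)) ` W. c v *\<^sub>R v) = (\<Sum>w\<in>W. (c (w, 1) *\<^sub>R w, c (w, 1)))"
    by (subst sum.reindex) (auto simp: inj_on_def)
  then show ?thesis by (simp add: sum_prod)
qed

lemma mem_pos_hull_iff: "(x, t) \<in> pos_hull \<longleftrightarrow> 0 \<le> t \<and> x \<in> (\<lambda>p. t *\<^sub>R p) ` P"
proof
  assume "(x, t) \<in> pos_hull"
  then obtain c :: "(real ^ 'd) \<times> real \<Rightarrow> real" where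
      "\<forall>v\<in>(\<lambda>w. (w, 1)) ` W. 0 \<le> c v" "(x, t) = (\<Sum>w\<in>W. c (w, 1) *\<^sub>R w, \<Sum>w\<in>W. c (w, 1))"
    unfolding pos_hull_def sum_lift by blast
  then have c: "\<And>w. w \<in> W \<Longrightarrow> 0 \<le> c (w, 1)"
      and x: "x = (\<Sum>w\<in>W. c (w, 1) *\<^sub>R w)" and t: "t = (\<Sum>w\<in>W. c (w, 1))"
    by auto
  have t0: "0 \<le> t" unfolding t by (intro sum_nonneg c)
  show "0 \<le> t \<and> x \<in> (\<lambda>p. t *\<^sub>R p) ` P"
  \<comment> \<open>At height zero only the apex remains; it is \<open>0 *\<^sub>R p\<close> for any
    \<open>p\<close> in the nonempty \<open>P\<close>.\<close>
  proof (cases "t = 0")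
    case True
    then have "\<forall>w\<in>W. c (w, 1) = 0" using t c W(1) by (simp add: sum_nonneg_eq_0_iff)
    then have "x = 0" unfolding x by simp
    moreover obtain p where "p \<in> P" using P(2) interior_subset by blast
    ultimately show ?thesis using True by auto
  next
    case False
    have "(1 / t) *\<^sub>R x \<in> P"
      unfolding P(1) convex_hull_finite[OF W(1)] mem_Collect_eq using c False t0
      by (intro exI[of _ "\<lambda>w. c (w, 1) / t"])
        (auto simp: x scaleR_sum_right sum_divide_distrib[symmetric] t)
    then show ?thesis using t0 False by (intro conjI image_eqI[of _ _ "(1 / t) *\<^sub>R x"]) auto
  qed
next
  assume "0 \<le> t \<and> x \<in> (\<lambda>p. t *\<^sub>R p) ` P"
  then obtain u where "0 \<le> t" "\<And>w. w \<in> W \<Longrightarrow> 0 \<le> u w" "sum u W = 1"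
      "x = t *\<^sub>R (\<Sum>w\<in>W. u w *\<^sub>R w)"
    unfolding P(1) convex_hull_finite[OF W(1)] by auto
  then show "(x, t) \<in> pos_hull"
    unfolding pos_hull_def mem_Collect_eq sum_lift
    by (intro exI[of _ "\<lambda>v. t * u (fst v)"])
      (auto simp: scaleR_sum_right sum_distrib_left[symmetric])
qed

lemma mem_pos_hull_dilate_iff: "(x, real n) \<in> pos_hull \<longleftrightarrow> x \<in> dilate n P"
  by (simp add: mem_pos_hull_iff dilate_def)

text \<open>Moving down along an interior direction stays in the cone near interior points of the
  slice; conversely, what was subtracted can be added back in all directions \<open>(p, 1)\<close>
  with \<open>p\<close> near \<open>p0\<close>.\<close>

lemma interior_dilate_iff:
  assumes n: "n \<ge> 1" and h: "h > 0" and p0: "p0 \<in> interior P"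
  shows "x \<in> interior (dilate n P) \<longleftrightarrow>
    eventually (\<lambda>\<epsilon>. (x, real n) - \<epsilon> *\<^sub>R (h *\<^sub>R p0, h) \<in> pos_hull) (at_right 0)"
proof
  assume x: "x \<in> interior (dilate n P)"
  define s where "s \<epsilon> = real n - \<epsilon> * h" for \<epsilon>
  \<comment> \<open>The shifted point, of height \<open>s \<epsilon>\<close>, rescaled back to
    height \<open>n\<close>; it tends to \<open>x\<close>.\<close>
  define y where "y \<epsilon> = (real n / s \<epsilon>) *\<^sub>R (x - \<epsilon> *\<^sub>R (h *\<^sub>R p0))" for \<epsilon>
  have s: "(s \<longlongrightarrow> real n - 0 * h) (at_right 0)"
    unfolding s_def by (intro tendsto_intros)
  then have "eventually (\<lambda>\<epsilon>. 0 < s \<epsilon>) (at_right 0)"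
    using order_tendstoD(1)[OF s, of 0] n by simp
  moreover have "(y \<longlongrightarrow> (real n / (real n - 0 * h)) *\<^sub>R (x - 0 *\<^sub>R (h *\<^sub>R p0))) (at_right 0)"
    unfolding y_def by (intro tendsto_intros s) (use n in auto)
  then have "(y \<longlongrightarrow> x) (at_right 0)" using n by simp
  then have "eventually (\<lambda>\<epsilon>. y \<epsilon> \<in> interior (dilate n P)) (at_right 0)"
    using x by (intro topological_tendstoD) auto
  ultimately show "eventually (\<lambda>\<epsilon>. (x, real n) - \<epsilon> *\<^sub>R (h *\<^sub>R p0, h) \<in> pos_hull) (at_right 0)"
  proof eventually_elim
    case (elim \<epsilon>)
    then have "(y \<epsilon>, real n) \<in> pos_hull" using interior_subset by (auto simp: mem_pos_hull_dilate_iff)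
    then have "(s \<epsilon> / real n) *\<^sub>R (y \<epsilon>, real n) \<in> pos_hull" using elim by (intro pos_hull_scaleR) auto
    then show ?case using elim n by (simp add: y_def s_def)
  qed
next
  assume "eventually (\<lambda>\<epsilon>. (x, real n) - \<epsilon> *\<^sub>R (h *\<^sub>R p0, h) \<in> pos_hull) (at_right 0)"
  with eventually_at_right_less[of "0::real"]
  have "eventually (\<lambda>\<epsilon>. 0 < \<epsilon> \<and> (x, real n) - \<epsilon> *\<^sub>R (h *\<^sub>R p0, h) \<in> pos_hull) (at_right 0)"
    by eventually_elim blast
  then obtain \<epsilon> where \<epsilon>: "0 < \<epsilon>" "(x, real n) - \<epsilon> *\<^sub>R (h *\<^sub>R p0, h) \<in> pos_hull"
    using eventually_happens'[OF trivial_limit_at_right_real] by blast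
  \<comment> \<open>A scaled copy of \<open>interior P\<close>, placed so that \<open>p0\<close>
    goes to \<open>x\<close>.\<close>
  define U where "U = (\<lambda>p. (x - (\<epsilon> * h) *\<^sub>R p0) + (\<epsilon> * h) *\<^sub>R p) ` interior P"
  show "x \<in> interior (dilate n P)"
  proof (rule interiorI)
    show "open U" unfolding U_def using \<epsilon> h by (intro open_affinity) auto
    show "x \<in> U" unfolding U_def using p0 by (intro image_eqI[of _ _ p0]) auto
    show "U \<subseteq> dilate n P"
    proof
      fix y assume "y \<in> U"
      then obtain p where p: "p \<in> P" "y = (x - (\<epsilon> * h) *\<^sub>R p0) + (\<epsilon> * h) *\<^sub>R p"
        unfolding U_def using interior_subset by blast
      have "(p, 1) \<in> pos_hull" using p by (simp add: mem_pos_hull_iff)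
      then have "(x, real n) - \<epsilon> *\<^sub>R (h *\<^sub>R p0, h) + (\<epsilon> * h) *\<^sub>R (p, 1) \<in> pos_hull"
        using \<epsilon> h by (intro pos_hull_add pos_hull_scaleR) auto
      then show "y \<in> dilate n P" by (simp add: p mem_pos_hull_dilate_iff)
    qed
  qed
qed

theorem ehrhart_h_star:
  obtains h :: "nat \<Rightarrow> nat" where
    "\<And>n. ehr P n = (\<Sum>j\<le>CARD('d)+1. h j * ((n + CARD('d) - j) choose CARD('d)))"
    "\<And>n. card (interior (dilate n P) \<inter> int_lattice) =
      (\<Sum>j\<le>CARD('d)+1. h (CARD('d) + 1 - j) * ((n + CARD('d) - j) choose CARD('d)))"
proof -
  \<comment> \<open>The open cone over \<open>interior P\<close>; a generic \<open>q\<close> in it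
    is an interior direction.\<close>
  define U where "U = {z :: (real ^ 'd) \<times> real. 0 < snd z} \<inter> (\<lambda>z. (1 / snd z) *\<^sub>R fst z) -` interior P"
  have "open U" unfolding U_def
    by (intro continuous_open_preimage continuous_intros open_Collect_less) auto
  moreover obtain p1 where "p1 \<in> interior P" using P(2) by blast
  then have "(p1, 1) \<in> U" by (simp add: U_def)
  ultimately obtain q where q: "q \<in> U" "generic q"
    using open_contains_generic[of U] by blast
  define s p0 where "s = snd q" and "p0 = (1 / s) *\<^sub>R fst q"
  have s: "s > 0" and p0: "p0 \<in> interior P" and q_eq: "q = (s *\<^sub>R p0, s)"
    using q(1) by (auto simp: U_def s_def p0_def prod_eq_iff)
  have "q \<in> pos_hull"
    unfolding q_eq mem_pos_hull_iff using s p0 interior_subset by auto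
  obtain h :: "nat \<Rightarrow> nat" where h:
    "\<And>n. card {x \<in> int_lattice \<times> \<int>. (0, 1) \<bullet> x = real n \<and> eventually (\<lambda>\<epsilon>. x + \<epsilon> *\<^sub>R q \<in> pos_hull) (at_right 0)} =
      (\<Sum>j\<le>CARD('d)+1. h j * ((n + CARD('d) - j) choose CARD('d)))"
    "\<And>n. card {x \<in> int_lattice \<times> \<int>. (0, 1) \<bullet> x = real n \<and> eventually (\<lambda>\<epsilon>. x - \<epsilon> *\<^sub>R q \<in> pos_hull) (at_right 0)} =
      (\<Sum>j\<le>CARD('d)+1. h (CARD('d) + 1 - j) * ((n + CARD('d) - j) choose CARD('d)))"
    by (rule h_star_exists[OF q(2), of "CARD('d)"]) (auto simp: Suc_le_eq)
  have card: "card {x \<in> int_lattice \<times> \<int>. (0, 1) \<bullet> x = real n \<and> Q x} = card (S \<inter> int_lattice)"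
    if "\<And>x. Q (x, real n) \<longleftrightarrow> x \<in> S" for Q n and S :: "(real ^ 'd) set"
  proof -
    have "{x \<in> int_lattice \<times> \<int>. (0, 1) \<bullet> x = real n \<and> Q x} = (\<lambda>x. (x, real n)) ` (S \<inter> int_lattice)"
      using that by (auto simp: inner_prod_def)
    then show ?thesis by (simp add: card_image inj_on_def)
  qed
  \<comment> \<open>Height zero is separate, as \<open>interior_dilate_iff\<close> needs
    \<open>n \<ge> 1\<close>: the shift has negative height, and a single point has empty
    interior.\<close>
  have int: "eventually (\<lambda>\<epsilon>. (x, real n) - \<epsilon> *\<^sub>R q \<in> pos_hull) (at_right 0) \<longleftrightarrow> x \<in> interior (dilate n P)" for x n
  proof (cases "n = 0")
    case True
    have "\<not> eventually (\<lambda>\<epsilon>. (x, real n) - \<epsilon> *\<^sub>R q \<in> pos_hull) (at_right 0)"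
    proof
      assume "eventually (\<lambda>\<epsilon>. (x, real n) - \<epsilon> *\<^sub>R q \<in> pos_hull) (at_right 0)"
      with eventually_at_right_less[of "0::real"]
      have "eventually (\<lambda>\<epsilon>::real. False) (at_right 0)"
      proof eventually_elim
        case (elim \<epsilon>)
        then show ?case using height_pos_hull_nonneg[OF elim(2)] s True by (simp add: q_eq inner_prod_def mult_le_0_iff)
      qed
      then show False by simp
    qed
    moreover have "dilate n P \<subseteq> {0}" using True by (auto simp: dilate_def)
    then have "interior (dilate n P) = {}"
      using interior_mono[of "dilate n P" "{0}"] by simp
    ultimately show ?thesis by simp
  next
    case False
    then show ?thesis unfolding q_eq using interior_dilate_iff[OF _ s p0] by simp
  qed
  show thesis
  proof (rule that)
    show "ehr P n = (\<Sum>j\<le>CARD('d)+1. h j * ((n + CARD('d) - j) choose CARD('d)))" for n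
      unfolding h(1)[symmetric] ehr_def
      by (rule card[symmetric]) (simp add: eventually_shift_in_pos_hull_iff[OF q(2) \<open>q \<in> pos_hull\<close>] mem_pos_hull_dilate_iff)
    show "card (interior (dilate n P) \<inter> int_lattice) =
      (\<Sum>j\<le>CARD('d)+1. h (CARD('d) + 1 - j) * ((n + CARD('d) - j) choose CARD('d)))" for n
      unfolding h(2)[symmetric] by (rule card[symmetric]) (rule int)
  qed
qed

end

theorem theorem1p6:
  fixes P :: "(real ^ 'd) set" and g :: nat and f :: "nat \<Rightarrow> real"
  assumes "lattice_polytope P"
    and "aff_dim P = int CARD('d)"
    and "gorenstein_of_index P g"
    and "is_f_star_vector P f"
  shows "\<forall>k::nat.
           (1/2) * (real CARD('d) + 1 + real_of_int \<lfloor>(real CARD('d) + 1 - real g) / 2\<rfloor>) \<le> real k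
           \<and> k \<le> CARD('d) \<longrightarrow> f (k - 1) > f k"
proof -
  obtain W where W: "finite W" "W \<subseteq> int_lattice" "P = convex hull W"
    using assms(1) unfolding lattice_polytope_def by blast
  have "convex P" by (simp add: W(3))
  \<comment> \<open>In full dimension the relative interior is the interior.\<close>
  then have "interior P \<noteq> {}"
    using assms(2) rel_interior_eq_empty[of P] interior_rel_interior[of P] by auto
  then interpret lattice_polytope_cone W P by unfold_locales (use W in auto)
  define I where "I n = card (interior (dilate n P) \<inter> int_lattice)" for n
  obtain h :: "nat \<Rightarrow> nat" where h:
      "\<And>n. ehr P n = (\<Sum>j\<le>CARD('d)+1. h j * ((n + CARD('d) - j) choose CARD('d)))"
      "\<And>n. I n = (\<Sum>j\<le>CARD('d)+1. h (CARD('d) + 1 - j) * ((n + CARD('d) - j) choose CARD('d)))"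
    unfolding I_def using ehrhart_h_star by blast
  have "P \<noteq> {}" using \<open>interior P \<noteq> {}\<close> interior_subset by blast
  then have dilate0: "dilate 0 P = {0}" by (auto simp: dilate_def)
  have L0: "ehr P 0 = 1" by (simp add: ehr_def dilate0 int_lattice_def)
  have G: "g \<ge> 1" "\<And>n. n < g \<Longrightarrow> I n = 0" "I g = 1" "\<And>n. n > g \<Longrightarrow> ehr P (n - g) = I n"
  proof -
    show "g \<ge> 1" "\<And>n. n > g \<Longrightarrow> ehr P (n - g) = I n"
      using assms(3) by (auto simp: gorenstein_of_index_def I_def)
    \<comment> \<open>The Gorenstein condition starts at \<open>n = 1\<close>; for
      \<open>n = 0\<close> the dilate is a point.\<close>
    show "I n = 0" if "n < g" for n
      using assms(3) that by (cases "n = 0") (auto simp: gorenstein_of_index_def I_def dilate0)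
    have "\<exists>!x. x \<in> interior (dilate g P) \<inter> int_lattice"
      using assms(3) unfolding gorenstein_of_index_def by blast
    then show "I g = 1"
      unfolding I_def by (metis card_1_singleton_iff One_nat_def is_singletonI' is_singleton_def empty_iff)
  qed
  have f: "\<And>n. n \<ge> 1 \<Longrightarrow> real (ehr P n) = (\<Sum>k=0..CARD('d). f k * real ((n - 1) choose k))"
    using assms(4) unfolding is_f_star_vector_def by blast
  have "1 \<le> CARD('d)" by (simp add: Suc_le_eq)
  note core = gorenstein_f_star_decreasing[where L = "ehr P" and I = I and f = f, OF this G(1) h L0 G(2-4) f]
  show ?thesis
  proof (intro allI impI, elim conjE)
    fix k :: nat
    assume k: "(1/2) * (real CARD('d) + 1 + real_of_int \<lfloor>(real CARD('d) + 1 - real g) / 2\<rfloor>) \<le> real k"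
      "k \<le> CARD('d)"
    \<comment> \<open>Since \<open>g \<le> CARD('d) + 1\<close>, real and natural subtraction agree
      and the floor becomes \<open>div\<close>.\<close>
    have "real CARD('d) + 1 - real g = real (CARD('d) + 1 - g)"
      using core(1) by simp
    then have "\<lfloor>(real CARD('d) + 1 - real g) / 2\<rfloor> = int ((CARD('d) + 1 - g) div 2)"
      using floor_divide_of_nat_eq[of "CARD('d) + 1 - g" 2] by simp
    then have "real (CARD('d) + 1 + (CARD('d) + 1 - g) div 2) \<le> real (2 * k)"
      using k(1) by simp
    then show "f (k - 1) > f k"
      using core(2)[of k] k(2) by linarith
  qed
qed

end
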